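(* For all integers $n\ge 1$ and $g\ge 0$, $$P_{g,n}(\mathbf{w})=(n+2g-1)!\;T_n(\mathbf{w})\;R_{g,n}(\mathbf{w}).$$
   Context: Let $\mathbb{C}_n[\mathbf{w}]$ be the ring of polynomials in commuting variables $w_{ij}$, $1\le i,j\le n$, $i\ne j$, modulo the relations $w_{ij}=w_{ji}$. For a transposition $\tau\in S_n$ exchanging $i$ and $j$, put $w(\tau)=w_{ij}$. A genus $g$ cycle factorization is a list of transpositions $\tau_1,\dots,\tau_{n+2g-1}\in S_n$ such that the product $\tau_{n+2g-1}\cdots\tau_1$ is an $n$-cycle. The Hurwitz polynomial is $P_{g,n}(\mathbf{w})=\sum w(\tau_1)\cdots w(\tau_{n+2g-1})$, where the sum runs over all genus $g$ cycle factorizations. $T_n(\mathbf{w})$ is the sum, over all spanning trees of the complete graph on $\{1,\dots,n\}$, of the product of the variables $w_{ij}$ over the edges $\{i,j\}$ of the tree. By convention $T_1=1$. $A_n$ is the $n\times n$ symmetric matrix with entries $(A_n)_{ii}=\sum_{j\ne i}w_{ij}$ and $(A_n)_{ij}=-w_{ij}$ for $i\ne j$. Let $\phi(t)=\frac{\sinh(t/2)}{t/2}$. Then $R_n(\mathbf{w})=\det\phi(A_n)$ is a formal power series in the $w_{ij}$, and $R_{g,n}$ denotes its homogeneous part of degree $2g$. *)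

theory Defs
  imports
    "HOL-Library.Poly_Mapping"
    "HOL-Computational_Algebra.Formal_Power_Series"
    "HOL-Combinatorics.Cycles"
    "Jordan_Normal_Form.Determinant"
begin

section \<open>Formal power series in several commuting variables\<close>

text \<open>Monomials are exponent vectors \<^typ>\<open>'v \<Rightarrow>\<^sub>0 nat\<close>, polynomials are
  finitely supported maps from monomials to coefficients, and formal power series are
  arbitrary maps from monomials to coefficients.\<close>

type_synonym ('v, 'a) mpoly = "('v \<Rightarrow>\<^sub>0 nat) \<Rightarrow>\<^sub>0 'a"

typedef ('v, 'a) mseries = "UNIV :: (('v \<Rightarrow>\<^sub>0 nat) \<Rightarrow> 'a) set"
  morphisms mcoeff Abs_mseries ..

setup_lifting type_definition_mseries

lemma mseries_eqI: "(\<And>m. mcoeff f m = mcoeff g m) \<Longrightarrow> f = g"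
  by transfer auto

definition monom_splits :: "('v \<Rightarrow>\<^sub>0 nat) \<Rightarrow> (('v \<Rightarrow>\<^sub>0 nat) \<times> ('v \<Rightarrow>\<^sub>0 nat)) set" where
  "monom_splits m = {(a, b). a + b = m}"

lemma finite_monom_splits [simp]: "finite (monom_splits m)"
proof -
  let ?K = "Poly_Mapping.keys m"
  let ?B = "\<lambda>v. {..Poly_Mapping.lookup m v}"
  let ?h = "\<lambda>p :: ('a \<Rightarrow>\<^sub>0 nat) \<times> ('a \<Rightarrow>\<^sub>0 nat). restrict (Poly_Mapping.lookup (fst p)) ?K"
  have zero: "Poly_Mapping.lookup a v = 0" if "a + b = m" "v \<notin> ?K" for a b v
  proof -
    have "Poly_Mapping.lookup a v + Poly_Mapping.lookup b v = Poly_Mapping.lookup m v"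
      using that(1) by (auto simp: lookup_add)
    with that(2) show ?thesis by (simp add: in_keys_iff)
  qed
  have "?h ` monom_splits m \<subseteq> PiE ?K ?B"
    by (auto simp: monom_splits_def lookup_add)
  moreover have "finite (PiE ?K ?B)" by (intro finite_PiE) auto
  ultimately have "finite (?h ` monom_splits m)" by (rule finite_subset)
  moreover have "inj_on ?h (monom_splits m)"
  proof (rule inj_onI, safe)
    fix a b a' b'
    assume ab: "(a, b) \<in> monom_splits m" and ab': "(a', b') \<in> monom_splits m"
      and eq: "?h (a, b) = ?h (a', b')"
    have "Poly_Mapping.lookup a v = Poly_Mapping.lookup a' v" for v
    proof (cases "v \<in> ?K")
      case True
      then show ?thesis using fun_cong[OF eq, of v] by simp
    next
      case False
      then show ?thesis using ab ab' zero unfolding monom_splits_def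
        by (metis (mono_tags, lifting) case_prodD mem_Collect_eq)
    qed
    then show a: "a = a'" by (rule poly_mapping_eqI)
    show "b = b'" using ab ab' a by (auto simp: monom_splits_def)
  qed
  ultimately show ?thesis by (rule finite_imageD)
qed

lemma monom_splits_0 [simp]: "monom_splits 0 = {(0, 0)}"
proof -
  have "a = 0 \<and> b = 0" if "a + b = 0" for a b :: "'v \<Rightarrow>\<^sub>0 nat"
  proof -
    have "Poly_Mapping.lookup a v + Poly_Mapping.lookup b v = 0" for v
      using that by (metis lookup_add lookup_zero)
    then show ?thesis by (auto intro: poly_mapping_eqI)
  qed
  then show ?thesis by (auto simp: monom_splits_def)
qed

instantiation mseries :: (type, comm_ring_1) comm_ring_1
begin

lift_definition zero_mseries :: "('a, 'b) mseries" is "\<lambda>_. 0" .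
lift_definition one_mseries :: "('a, 'b) mseries" is "\<lambda>m. if m = 0 then 1 else 0" .
lift_definition plus_mseries :: "('a, 'b) mseries \<Rightarrow> ('a, 'b) mseries \<Rightarrow> ('a, 'b) mseries"
  is "\<lambda>f g m. f m + g m" .
lift_definition minus_mseries :: "('a, 'b) mseries \<Rightarrow> ('a, 'b) mseries \<Rightarrow> ('a, 'b) mseries"
  is "\<lambda>f g m. f m - g m" .
lift_definition uminus_mseries :: "('a, 'b) mseries \<Rightarrow> ('a, 'b) mseries"
  is "\<lambda>f m. - f m" .
lift_definition times_mseries :: "('a, 'b) mseries \<Rightarrow> ('a, 'b) mseries \<Rightarrow> ('a, 'b) mseries"
  is "\<lambda>f g m. \<Sum>(a, b)\<in>monom_splits m. f a * g b" .

instance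
proof
  fix f g h :: "('a, 'b) mseries"
  show "f * g * h = f * (g * h)"
  proof (transfer, rule ext)
    fix f g h :: "('a \<Rightarrow>\<^sub>0 nat) \<Rightarrow> 'b" and m
    have "(\<Sum>(p, c)\<in>monom_splits m. (\<Sum>(a, b)\<in>monom_splits p. f a * g b) * h c)
        = (\<Sum>((p, c), (a, b))\<in>Sigma (monom_splits m) (\<lambda>(p, c). monom_splits p). f a * g b * h c)"
      by (subst sum.Sigma[symmetric]) (auto simp: sum_distrib_right split_def)
    also have "\<dots> = (\<Sum>((a, q), (b, c))\<in>Sigma (monom_splits m) (\<lambda>(a, q). monom_splits q). f a * (g b * h c))"
      by (rule sum.reindex_bij_witness[of _
            "\<lambda>((a, q), (b, c)). ((a + b, c), (a, b))" "\<lambda>((p, c), (a, b)). ((a, b + c), (b, c))"])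
         (auto simp: monom_splits_def ac_simps)
    also have "\<dots> = (\<Sum>(a, q)\<in>monom_splits m. f a * (\<Sum>(b, c)\<in>monom_splits q. g b * h c))"
      by (subst sum.Sigma[symmetric]) (auto simp: sum_distrib_left split_def)
    finally show "(\<Sum>(p, c)\<in>monom_splits m. (\<Sum>(a, b)\<in>monom_splits p. f a * g b) * h c)
        = (\<Sum>(a, q)\<in>monom_splits m. f a * (\<Sum>(b, c)\<in>monom_splits q. g b * h c))" .
  qed
  show "f * g = g * f"
    by (transfer, rule ext,
        rule sum.reindex_bij_witness[of _ "\<lambda>(a, b). (b, a)" "\<lambda>(a, b). (b, a)"])
       (auto simp: monom_splits_def ac_simps)
  show "1 * f = f"
  proof (transfer, rule ext)
    fix f :: "('a \<Rightarrow>\<^sub>0 nat) \<Rightarrow> 'b" and m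
    have "(\<Sum>(a, b)\<in>monom_splits m. (if a = 0 then 1 else 0) * f b)
        = (\<Sum>(a, b)\<in>{(0 :: 'a \<Rightarrow>\<^sub>0 nat, m)}. (if a = 0 then 1 else 0) * f b)"
      by (rule sum.mono_neutral_right[OF finite_monom_splits])
         (auto simp: monom_splits_def split: if_splits)
    then show "(\<Sum>(a, b)\<in>monom_splits m. (if a = 0 then 1 else 0) * f b) = f m" by simp
  qed
  show "(f + g) * h = f * h + g * h"
    by (transfer, rule ext) (simp add: split_def distrib_right sum.distrib)
  show "f + g + h = f + (g + h)" by transfer (simp add: ac_simps)
  show "f + g = g + f" by transfer (simp add: ac_simps)
  show "0 + f = f" by transfer simp
  show "- f + f = 0" by transfer simp
  show "f - g = f + - g" by transfer simp
  show "(0 :: ('a, 'b) mseries) \<noteq> 1" by transfer (auto dest: fun_cong[of _ _ 0])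
qed

end

text \<open>The inclusion of polynomials into power series.\<close>

definition series_of_poly :: "('v, 'a::zero) mpoly \<Rightarrow> ('v, 'a) mseries" where
  "series_of_poly p = Abs_mseries (Poly_Mapping.lookup p)"

lemma mcoeff_series_of_poly [simp]: "mcoeff (series_of_poly p) m = Poly_Mapping.lookup p m"
  by (simp add: series_of_poly_def Abs_mseries_inverse)

lemma series_of_poly_inject [simp]: "series_of_poly p = series_of_poly q \<longleftrightarrow> p = q"
  by (metis mcoeff_series_of_poly poly_mapping_eqI)

lemma series_of_poly_0 [simp]: "series_of_poly 0 = 0"
  by (rule mseries_eqI) (simp add: zero_mseries.rep_eq)

lemma series_of_poly_1 [simp]: "series_of_poly 1 = 1"
  by (rule mseries_eqI) (simp add: one_mseries.rep_eq lookup_one when_def)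

lemma series_of_poly_add [simp]: "series_of_poly (p + q) = series_of_poly p + series_of_poly q"
  by (rule mseries_eqI) (simp add: plus_mseries.rep_eq lookup_add)

lemma series_of_poly_mult [simp]: "series_of_poly (p * q) = series_of_poly p * series_of_poly q"
proof (rule mseries_eqI)
  fix m
  let ?p = "Poly_Mapping.lookup p" and ?q = "Poly_Mapping.lookup q"
  have "mcoeff (series_of_poly (p * q)) m = (\<Sum>(a, b). ?p a * ?q b when m = a + b)"
    by (simp add: times_poly_mapping.rep_eq prod_fun_unfold_prod)
  also have "\<dots> = (\<Sum>(a, b)\<in>monom_splits m. ?p a * ?q b when m = a + b)"
    by (rule Sum_any.expand_superset[OF finite_monom_splits]) (auto simp: monom_splits_def)
  also have "\<dots> = (\<Sum>(a, b)\<in>monom_splits m. ?p a * ?q b)"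
    by (rule sum.cong) (auto simp: monom_splits_def)
  finally show "mcoeff (series_of_poly (p * q)) m = mcoeff (series_of_poly p * series_of_poly q) m"
    by (simp add: times_mseries.rep_eq)
qed

definition monom_degree :: "('v \<Rightarrow>\<^sub>0 nat) \<Rightarrow> nat" where
  "monom_degree m = (\<Sum>v\<in>Poly_Mapping.keys m. Poly_Mapping.lookup m v)"

lift_definition homogeneous_part :: "nat \<Rightarrow> ('v, 'a::zero) mseries \<Rightarrow> ('v, 'a) mseries"
  is "\<lambda>d f m. if monom_degree m = d then f m else 0" .


section \<open>The variables and the Hurwitz polynomial\<close>

text \<open>Indexing variables by the unordered pair \<open>{i, j}\<close> builds in \<open>w\<^sub>i\<^sub>j = w\<^sub>j\<^sub>i\<close>.
  The type has variables for all sets of naturals, but the polynomials below only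
  involve those for two-element subsets of \<open>{1..n}\<close>.\<close>

definition edge_var :: "nat set \<Rightarrow> (nat set, complex) mpoly" where
  "edge_var e = Poly_Mapping.single (Poly_Mapping.single e 1) 1"

definition w :: "nat \<Rightarrow> nat \<Rightarrow> (nat set, complex) mpoly" where
  "w i j = edge_var {i, j}"

text \<open>For a transposition of \<open>i\<close> and \<open>j\<close>, the set of moved points is \<open>{i, j}\<close>.\<close>

definition w_transp :: "(nat \<Rightarrow> nat) \<Rightarrow> (nat set, complex) mpoly" where
  "w_transp \<tau> = edge_var {x. \<tau> x \<noteq> x}"

lemma w_transp_transpose: "i \<noteq> j \<Longrightarrow> w_transp (transpose i j) = w i j"
  unfolding w_transp_def w_def by (rule arg_cong[of _ _ edge_var]) (auto simp: transpose_def)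

definition transpositions :: "nat \<Rightarrow> (nat \<Rightarrow> nat) set" where
  "transpositions n = {transpose i j | i j. i \<in> {1..n} \<and> j \<in> {1..n} \<and> i \<noteq> j}"

definition is_full_cycle :: "nat \<Rightarrow> (nat \<Rightarrow> nat) \<Rightarrow> bool" where
  "is_full_cycle n p \<longleftrightarrow> (\<exists>cs. cycle cs \<and> set cs = {1..n} \<and> p = cycle_of_list cs)"

text \<open>Here \<open>fold (\<circ>) [\<tau>\<^sub>1, \<dots>, \<tau>\<^sub>m] id = \<tau>\<^sub>m \<circ> \<dots> \<circ> \<tau>\<^sub>1\<close>.
  The subtraction is only meant for \<open>n \<ge> 1\<close>.\<close>

definition cycle_factorizations :: "nat \<Rightarrow> nat \<Rightarrow> (nat \<Rightarrow> nat) list set" where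
  "cycle_factorizations g n = {ts. length ts = n + 2 * g - 1 \<and> set ts \<subseteq> transpositions n \<and>
     is_full_cycle n (fold (\<circ>) ts id)}"

lemma finite_transpositions: "finite (transpositions n)"
proof (rule finite_subset)
  show "transpositions n \<subseteq> (\<lambda>(i, j). transpose i j) ` ({1..n} \<times> {1..n})"
    by (auto simp: transpositions_def)
qed auto

lemma finite_cycle_factorizations: "finite (cycle_factorizations g n)"
proof (rule finite_subset)
  show "cycle_factorizations g n \<subseteq> {ts. set ts \<subseteq> transpositions n \<and> length ts = n + 2 * g - 1}"
    by (auto simp: cycle_factorizations_def)
qed (rule finite_lists_length_eq[OF finite_transpositions])

definition hurwitz_poly :: "nat \<Rightarrow> nat \<Rightarrow> (nat set, complex) mpoly" where
  "hurwitz_poly g n = (\<Sum>ts\<in>cycle_factorizations g n. prod_list (map w_transp ts))"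


section \<open>The spanning tree polynomial\<close>

definition complete_edges :: "nat \<Rightarrow> nat set set" where
  "complete_edges n = {{i, j} | i j. i \<in> {1..n} \<and> j \<in> {1..n} \<and> i \<noteq> j}"

definition graph_connected :: "nat set \<Rightarrow> nat set set \<Rightarrow> bool" where
  "graph_connected V E \<longleftrightarrow> (\<forall>u\<in>V. \<forall>v\<in>V. (u, v) \<in> {(x, y). {x, y} \<in> E}\<^sup>*)"

definition graph_acyclic :: "nat set set \<Rightarrow> bool" where
  "graph_acyclic E \<longleftrightarrow> \<not> (\<exists>vs. distinct vs \<and> length vs \<ge> 3 \<and>
     (\<forall>i<length vs. {vs ! i, vs ! (Suc i mod length vs)} \<in> E))"

definition spanning_trees :: "nat \<Rightarrow> nat set set set" where
  "spanning_trees n = {E. E \<subseteq> complete_edges n \<and> graph_connected {1..n} E \<and> graph_acyclic E}"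

lemma finite_spanning_trees: "finite (spanning_trees n)"
proof (rule finite_subset)
  have "complete_edges n \<subseteq> Pow {1..n}" by (auto simp: complete_edges_def)
  then have "finite (complete_edges n)" by (rule finite_subset) auto
  then show "finite (Pow (complete_edges n))" by simp
qed (auto simp: spanning_trees_def)

definition tree_poly :: "nat \<Rightarrow> (nat set, complex) mpoly" where
  "tree_poly n = (\<Sum>E\<in>spanning_trees n. \<Prod>e\<in>E. edge_var e)"

lemma tree_poly_1: "tree_poly 1 = 1"
proof -
  have "graph_acyclic {}"
    by (auto simp: graph_acyclic_def intro: exI[of _ 0])
  then have "spanning_trees 1 = {{}}"
    by (auto simp: spanning_trees_def complete_edges_def graph_connected_def)
  then show ?thesis by (simp add: tree_poly_def)
qed


section \<open>The determinantal series\<close>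

text \<open>Row and column \<open>i\<close> of the matrix (counted from 0) belong to the vertex \<open>i + 1\<close>.\<close>

definition laplacian_entry :: "nat \<Rightarrow> nat \<Rightarrow> nat \<Rightarrow> (nat set, complex) mpoly" where
  "laplacian_entry n i j = (if i = j then \<Sum>k\<in>{1..n} - {i}. w i k else - w i j)"

definition laplacian :: "nat \<Rightarrow> (nat set, complex) mpoly mat" where
  "laplacian n = mat n n (\<lambda>(i, j). laplacian_entry n (i + 1) (j + 1))"

definition sinh_half :: "complex fps" where
  "sinh_half = fps_const (1/2) * (fps_exp (1/2) - fps_exp (- (1/2)))"

definition phi :: "complex fps" where
  "phi = sinh_half / (fps_const (1/2) * fps_X)"

lemma phi_nth: "fps_nth phi k = (if even k then 1 / (2 ^ k * fact (k + 1)) else 0)"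
proof -
  have X: "fps_const (1/2) * fps_X \<noteq> (0 :: complex fps)" by simp
  have "sinh_half = (fps_const (1/2) * fps_X) *
      Abs_fps (\<lambda>k. if even k then 1 / (2 ^ k * fact (k + 1)) else 0)"
  proof (rule fps_ext)
    fix m
    show "fps_nth sinh_half m = fps_nth ((fps_const (1/2) * fps_X) *
        Abs_fps (\<lambda>k. if even k then 1 / (2 ^ k * fact (k + 1)) else 0)) m"
      by (cases m) (auto simp: sinh_half_def mult.assoc power_minus_odd power_one_over
            field_simps simp del: fact_Suc)
  qed
  then have phi: "phi = Abs_fps (\<lambda>k. if even k then 1 / (2 ^ k * fact (k + 1)) else 0)"
    unfolding phi_def using X by (metis nonzero_mult_div_cancel_left)
  show ?thesis by (simp only: phi fps_nth_Abs_fps)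
qed

text \<open>\<open>f(A) = \<Sum>\<^sub>k f\<^sub>k A\<^sup>k\<close>, entry by entry and coefficient by coefficient.
  \<^const>\<open>Sum_any\<close> sums over the finitely many nonzero terms; that there are only
  finitely many of them for the Laplacian is \<open>finite_laplacian_terms\<close> below.\<close>

definition fps_mat_eval :: "complex fps \<Rightarrow> (nat set, complex) mpoly mat \<Rightarrow> (nat set, complex) mseries mat"
  where "fps_mat_eval f A = mat (dim_row A) (dim_col A) (\<lambda>(i, j). Abs_mseries (\<lambda>m.
    Sum_any (\<lambda>k. fps_nth f k * Poly_Mapping.lookup ((A ^\<^sub>m k) $$ (i, j)) m)))"

definition R_series :: "nat \<Rightarrow> (nat set, complex) mseries" where
  "R_series n = det (fps_mat_eval phi (laplacian n))"

definition R_part :: "nat \<Rightarrow> nat \<Rightarrow> (nat set, complex) mseries" where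
  "R_part g n = homogeneous_part (2 * g) (R_series n)"

definition hom_poly :: "nat \<Rightarrow> ('v, 'a::zero) mpoly \<Rightarrow> bool" where
  "hom_poly d p \<longleftrightarrow> (\<forall>m\<in>Poly_Mapping.keys p. monom_degree m = d)"

lemma monom_degree_add: "monom_degree (a + b) = monom_degree a + monom_degree b"
proof -
  let ?K = "Poly_Mapping.keys a \<union> Poly_Mapping.keys b"
  have deg: "monom_degree c = (\<Sum>v\<in>?K. Poly_Mapping.lookup c v)" if "Poly_Mapping.keys c \<subseteq> ?K" for c
    unfolding monom_degree_def by (rule sum.mono_neutral_left) (use that in \<open>auto simp: in_keys_iff\<close>)
  show ?thesis
    using deg[of a] deg[of b] deg[OF Poly_Mapping.keys_add] by (simp add: lookup_add sum.distrib)
qed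

lemma hom_poly_0: "hom_poly d 0"
  by (simp add: hom_poly_def)

lemma hom_poly_1: "hom_poly 0 (1 :: ('v, 'a::zero_neq_one) mpoly)"
  by (auto simp: hom_poly_def in_keys_iff lookup_one when_def monom_degree_def split: if_splits)

lemma hom_poly_uminus: "hom_poly d (p :: ('v, 'a::ab_group_add) mpoly) \<Longrightarrow> hom_poly d (- p)"
  by (auto simp: hom_poly_def in_keys_iff)

lemma hom_poly_add:
  "hom_poly d p \<Longrightarrow> hom_poly d q \<Longrightarrow> hom_poly d (p + q :: ('v, 'a::comm_monoid_add) mpoly)"
  unfolding hom_poly_def using Poly_Mapping.keys_add[of p q] by blast

lemma hom_poly_sum:
  "(\<And>i. i \<in> I \<Longrightarrow> hom_poly d (p i)) \<Longrightarrow> hom_poly d (\<Sum>i\<in>I. p i :: ('v, 'a::comm_monoid_add) mpoly)"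
  by (induction I rule: infinite_finite_induct) (auto intro: hom_poly_0 hom_poly_add)

lemma hom_poly_mult:
  "hom_poly d p \<Longrightarrow> hom_poly e q \<Longrightarrow> hom_poly (d + e) (p * q :: ('v, 'a::semiring_0) mpoly)"
  unfolding hom_poly_def using keys_mult[of p q] by (fastforce simp: monom_degree_add)

lemma hom_poly_laplacian_entry: "hom_poly 1 (laplacian_entry n i j)"
proof -
  have "hom_poly 1 (w a b)" for a b
    by (simp add: hom_poly_def w_def edge_var_def monom_degree_def)
  then show ?thesis
    unfolding laplacian_entry_def by (auto intro: hom_poly_sum hom_poly_uminus)
qed

lemma hom_poly_laplacian_power:
  "i < n \<Longrightarrow> j < n \<Longrightarrow> hom_poly k ((laplacian n ^\<^sub>m k) $$ (i, j))"
proof (induction k arbitrary: i j)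
  case 0
  then show ?case by (auto simp: laplacian_def hom_poly_0 hom_poly_1)
next
  case (Suc k)
  have car: "laplacian n \<in> carrier_mat n n" "laplacian n ^\<^sub>m k \<in> carrier_mat n n"
    by (auto simp: laplacian_def)
  have "(laplacian n ^\<^sub>m Suc k) $$ (i, j)
      = (\<Sum>l = 0..<n. (laplacian n ^\<^sub>m k) $$ (i, l) * laplacian n $$ (l, j))"
    using Suc.prems car by (simp add: scalar_prod_def)
  also have "hom_poly (k + 1) \<dots>"
    using Suc hom_poly_laplacian_entry
    by (intro hom_poly_sum hom_poly_mult) (auto simp: laplacian_def simp flip: One_nat_def)
  finally show ?case by simp
qed

lemma finite_laplacian_terms:
  assumes "i < n" "j < n"
  shows "finite {k. fps_nth f k * Poly_Mapping.lookup ((laplacian n ^\<^sub>m k) $$ (i, j)) m \<noteq> 0}"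
proof (rule finite_subset)
  show "{k. fps_nth f k * Poly_Mapping.lookup ((laplacian n ^\<^sub>m k) $$ (i, j)) m \<noteq> 0} \<subseteq> {monom_degree m}"
    using hom_poly_laplacian_power[OF assms] by (auto simp: hom_poly_def in_keys_iff)
qed auto

end

theory Submission
  imports Defs "HOL-Combinatorics.Multiset_Permutations"
begin

text \<open>Let \<open>J\<close> be the all-ones matrix. For a permutation matrix \<open>P\<close> of size \<open>n\<close>, the determinant of
  \<open>1 + J - P\<close> is a nonzero constant if \<open>P\<close> is an \<open>n\<close>-cycle, and 0 otherwise. A transposition is
  a rank one perturbation of the identity, so \<open>det (1 + J - P)\<close> responds affinely when \<open>P\<close> is
  multiplied by it; hence the exponential generating function in \<open>t\<close> of
  \<open>det (1 + J - P\<^sub>\<tau>\<^sub>m \<cdots> P\<^sub>\<tau>\<^sub>1)\<close>, weighted by \<open>w(\<tau>\<^sub>1) \<cdots> w(\<tau>\<^sub>m)\<close>, satisfies a linear differential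
  equation and equals \<open>exp (t W) det (1 + J - exp (- t A))\<close>, where \<open>W\<close> is the sum of all
  variables and \<open>A\<close> is the Laplacian. As \<open>J A = 0\<close> and \<open>tr A = 2 W\<close>, this is
  \<open>det (J + t A) det \<phi>(t A)\<close>, and \<open>det (J + t A)\<close> is a multiple of \<open>t ^ (n - 1)\<close>. The multiple
  is found from the genus 0 case, where the factorizations are exactly the orderings of the edges
  of spanning trees.\<close>

section \<open>Determinants of matrices given by entry functions\<close>

text \<open>\<open>phi\<close> enters through the scalar identity 1 - exp(-x) = x phi(x) exp(-x/2).
  Because J A = 0, every series f satisfies J f(tA) = f(0) J, so J + 1 - exp(-tA) factors as (J +
  tA) phi(tA) exp(-tA/2). The last factor has determinant exp(-tW), which cancels the prefactor
  exp(tW). The obstacle is that the determinant is not affine in P as a whole, so the weighted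
  products cannot be summed inside it. It is affine along each rank one direction, and the weighted
  transposition matrices sum to W - A: the W accounts for the prefactor, the -A for the exponential
  inside the determinant. Only the ratio between the value on n-cycles and the factor of t^(n-1)
  enters, and it is read off at t^(n-1), where det phi(tA) contributes 1. The entries lie in a
  general commutative ring, so complex scalars act through a homomorphism \<open>\<kappa>\<close>,
  and only images of nonzero complex numbers are inverted. The variable t also records the degree,
  so that homogeneous parts become coefficients of t.\<close>

definition fdet :: "nat \<Rightarrow> (nat \<Rightarrow> nat \<Rightarrow> 'a::comm_ring_1) \<Rightarrow> 'a" where
  "fdet n f = det (mat n n (\<lambda>(i, j). f i j))"

definition mmul :: "nat \<Rightarrow> (nat \<Rightarrow> nat \<Rightarrow> 'a::comm_ring_1) \<Rightarrow> (nat \<Rightarrow> nat \<Rightarrow> 'a) \<Rightarrow> nat \<Rightarrow> nat \<Rightarrow> 'a" where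
  "mmul n f g i j = (\<Sum>k<n. f i k * g k j)"

lemma fdet_Leibniz: "fdet n f = (\<Sum>p | p permutes {0..<n}. signof p * (\<Prod>i<n. f i (p i)))"
  unfolding fdet_def det_def
  by (auto intro!: sum.cong prod.cong simp: permutes_in_image lessThan_atLeast0)

lemma fdet_cong: "(\<And>i j. i < n \<Longrightarrow> j < n \<Longrightarrow> f i j = g i j) \<Longrightarrow> fdet n f = fdet n g"
  unfolding fdet_def by (intro arg_cong[of _ _ det] cong_mat) auto

lemma (in comm_ring_hom) hom_fdet: "hom (fdet n f) = fdet n (\<lambda>i j. hom (f i j))"
  unfolding fdet_def hom_det[symmetric] by (intro arg_cong[of _ _ det]) auto

lemma fdet_mmul: "fdet n (mmul n f g) = fdet n f * fdet n g"
proof -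
  have "mat n n (\<lambda>(i, j). mmul n f g i j) = mat n n (\<lambda>(i, j). f i j) * mat n n (\<lambda>(i, j). g i j)"
    by (intro eq_matI) (auto simp: mmul_def scalar_prod_def lessThan_atLeast0)
  then show ?thesis
    unfolding fdet_def by (simp add: det_mult[of _ n])
qed

lemma fdet_one: "fdet n (\<lambda>i j. if i = j then 1 else 0) = 1"
  using det_one[of n, where 'a='a] unfolding fdet_def one_mat_def by simp

text \<open>Each Leibniz term contains row \<open>i\<close> in exactly one factor. Isolating that
  factor makes row linearity, and later the derivative of a determinant, a rearrangement of
  sums.\<close>

lemma fdet_upd_Leibniz:
  assumes "i < n"
  shows "fdet n (f(i := z)) = (\<Sum>p | p permutes {0..<n}. signof p * (z (p i) * (\<Prod>k\<in>{..<n} - {i}. f k (p k))))"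
  unfolding fdet_Leibniz
proof (intro sum.cong refl arg_cong2[of _ _ _ _ "(*)"])
  fix p
  show "(\<Prod>k<n. (f(i := z)) k (p k)) = z (p i) * (\<Prod>k\<in>{..<n} - {i}. f k (p k))"
    using assms by (subst prod.remove[of _ i]) (auto intro!: prod.cong)
qed

lemma fdet_row_sum:
  assumes "i < n" "finite T"
  shows "fdet n (f(i := \<lambda>j. \<Sum>t\<in>T. c t * z t j)) = (\<Sum>t\<in>T. c t * fdet n (f(i := z t)))"
  unfolding fdet_upd_Leibniz[OF assms(1)] sum_distrib_left sum_distrib_right
  by (subst sum.swap) (simp add: mult_ac)

lemma fdet_row_add:
  assumes "i < n"
  shows "fdet n (f(i := \<lambda>j. y j + c * z j)) = fdet n (f(i := y)) + c * fdet n (f(i := z))"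
  unfolding fdet_upd_Leibniz[OF assms(1)] sum_distrib_left sum.distrib[symmetric]
  by (intro sum.cong refl) (simp add: algebra_simps)

lemma fdet_eq_rows:
  assumes "i < n" "j < n" "i \<noteq> j" "f i = f j"
  shows "fdet n f = 0"
  unfolding fdet_def by (rule det_identical_rows[of _ n i j]) (use assms in auto)

text \<open>The terms with \<open>k \<noteq> i\<close> have two equal rows. Serves twice: for the
  singularity of the Laplacian, and to leave only diagonal entries in the derivative of det
  exp(-tA/2).\<close>

lemma fdet_row_combination:
  assumes "i < n"
  shows "fdet n (f(i := \<lambda>j. \<Sum>k<n. b k * f k j)) = b i * fdet n f"
proof -
  have "fdet n (f(i := f k)) = (if k = i then fdet n f else 0)" if "k < n" for k
    using fdet_eq_rows[of i n k "f(i := f k)"] assms that by auto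
  then show ?thesis
    using assms by (subst fdet_row_sum) (auto simp: if_distrib[of "\<lambda>x. _ * x"] cong: if_cong)
qed

text \<open>A division-free matrix determinant lemma: rows are perturbed one at a time, and a term
  with \<open>z\<close> in two rows vanishes.\<close>

lemma fdet_rank_one:
  "fdet n (\<lambda>i j. f i j + u i * z j) = fdet n f + (\<Sum>i<n. u i * fdet n (f(i := z)))"
proof -
  define g where "g k i = (if i < k then \<lambda>j. f i j + u i * z j else f i)" for k i
  \<comment> \<open>Once row \<open>k\<close> is \<open>z\<close>, adding multiples of
    \<open>z\<close> to earlier rows changes nothing.\<close>
  have replaced: "fdet n ((g l)(k := z)) = fdet n (f(k := z))" if "l \<le> k" "k < n" for l k
    using that(1)
  proof (induction l)
    case 0
    then show ?case by (simp add: g_def cong: if_cong)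
  next
    case (Suc l)
    have "(g (Suc l))(k := z) = ((g l)(k := z))(l := \<lambda>j. f l j + u l * z j)"
      using Suc.prems by (auto simp: g_def fun_eq_iff)
    then have "fdet n ((g (Suc l))(k := z)) =
        fdet n (((g l)(k := z))(l := f l)) + u l * fdet n (((g l)(k := z))(l := z))"
      using Suc.prems that by (simp only:) (rule fdet_row_add, simp)
    moreover have "((g l)(k := z))(l := f l) = (g l)(k := z)"
      using Suc.prems by (auto simp: g_def fun_eq_iff)
    moreover have "fdet n (((g l)(k := z))(l := z)) = 0"
      using Suc.prems that by (intro fdet_eq_rows[of l n k]) auto
    ultimately show ?case
      using Suc by (simp del: fun_upd_apply)
  qed
  have "fdet n (g k) = fdet n f + (\<Sum>i<k. u i * fdet n (f(i := z)))" if "k \<le> n" for k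
    using that
  proof (induction k)
    case 0
    then show ?case by (simp add: g_def)
  next
    case (Suc k)
    have "g (Suc k) = (g k)(k := \<lambda>j. f k j + u k * z j)" "(g k)(k := f k) = g k"
      by (auto simp: g_def fun_eq_iff)
    then have "fdet n (g (Suc k)) = fdet n (g k) + u k * fdet n ((g k)(k := z))"
      using Suc.prems fdet_row_add[of k n "g k" "f k" "u k" z] by (simp del: fun_upd_apply)
    then show ?case
      using Suc replaced[of k k] by (simp del: fun_upd_apply)
  qed
  from this[of n] show ?thesis
    using fdet_cong[of n "g n" "\<lambda>i j. f i j + u i * z j"] by (simp add: g_def)
qed

section \<open>Derivatives of products and determinants of power series\<close>

lemma fps_deriv_prod:
  "finite A \<Longrightarrow> fps_deriv (\<Prod>i\<in>A. f i) = (\<Sum>i\<in>A. fps_deriv (f i) * (\<Prod>k\<in>A - {i}. f k))"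
proof (induction A rule: finite_induct)
  case (insert x A)
  have "(\<Prod>k\<in>insert x A - {i}. f k) = f x * (\<Prod>k\<in>A - {i}. f k)" if "i \<in> A" for i
  proof -
    have "insert x A - {i} = insert x (A - {i})" using insert that by auto
    then show ?thesis using insert by simp
  qed
  then have "(\<Sum>i\<in>A. fps_deriv (f i) * (\<Prod>k\<in>insert x A - {i}. f k)) =
      f x * (\<Sum>i\<in>A. fps_deriv (f i) * (\<Prod>k\<in>A - {i}. f k))"
    by (simp add: sum_distrib_left mult_ac)
  then show ?case
    using insert by (simp add: add.commute)
qed simp

lemma fps_deriv_fdet:
  fixes f :: "nat \<Rightarrow> nat \<Rightarrow> 'a::comm_ring_1 fps"
  shows "fps_deriv (fdet n f) = (\<Sum>i<n. fdet n (f(i := \<lambda>j. fps_deriv (f i j))))"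
proof -
  have signof: "fps_deriv (signof p) = (0 :: 'a fps)" for p :: "nat \<Rightarrow> nat"
    by (simp add: sign_def)
  have "fps_deriv (fdet n f) = (\<Sum>p | p permutes {0..<n}.
      \<Sum>i<n. signof p * (fps_deriv (f i (p i)) * (\<Prod>k\<in>{..<n} - {i}. f k (p k))))"
    unfolding fdet_Leibniz fps_deriv_sum
    by (intro sum.cong refl) (simp add: fps_deriv_prod signof sum_distrib_left)
  then show ?thesis
    by (subst (asm) sum.swap) (simp add: fdet_upd_Leibniz)
qed

section \<open>Spanning trees\<close>

abbreviation adj :: "nat set set \<Rightarrow> (nat \<times> nat) set" where
  "adj E \<equiv> {(x, y). {x, y} \<in> E}"

lemma sym_adj: "sym (adj E)"
  by (auto simp: sym_def insert_commute)

lemma adj_rtrancl_sym: "(x, y) \<in> (adj E)\<^sup>* \<Longrightarrow> (y, x) \<in> (adj E)\<^sup>*"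
  using sym_rtrancl[OF sym_adj] by (auto dest: symD)

lemma complete_edges_Pow: "complete_edges n \<subseteq> Pow {1..n}"
  by (auto simp: complete_edges_def)

lemma finite_complete_edges: "finite (complete_edges n)"
  using complete_edges_Pow by (rule finite_subset) auto

text \<open>The breadth-first tree from vertex 1: every other vertex keeps one edge to a neighbour
  at smaller distance \<open>d\<close>.\<close>

lemma graph_connected_parent_edges:
  assumes con: "graph_connected {1..n} E" and E: "E \<subseteq> complete_edges n" and n: "n \<ge> 1"
  obtains F where "F \<subseteq> E" "graph_connected {1..n} F" "card F = n - 1"
proof -
  define d where "d v = (LEAST k. (1, v) \<in> adj E ^^ k)" for v
  have dist: "(1, v) \<in> adj E ^^ d v" if "v \<in> {1..n}" for v
  proof -
    have "(1, v) \<in> (adj E)\<^sup>*"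
      using con that n by (auto simp: graph_connected_def)
    then obtain k where "(1, v) \<in> adj E ^^ k"
      unfolding rtrancl_power by blast
    then show ?thesis
      unfolding d_def by (rule LeastI)
  qed
  have "\<exists>u. u \<in> {1..n} \<and> {u, v} \<in> E \<and> d u < d v" if v: "v \<in> {2..n}" for v
  proof -
    have "d v \<noteq> 0"
      using dist[of v] v by (intro notI) auto
    then obtain k where k: "d v = Suc k"
      using not0_implies_Suc by blast
    then obtain u where u: "(1, u) \<in> adj E ^^ k" "{u, v} \<in> E"
      using dist[of v] v by auto
    then have "u \<in> {1..n}"
      using E complete_edges_Pow by blast
    moreover have "d u \<le> k"
      unfolding d_def using u by (auto intro: Least_le)
    ultimately show ?thesis
      using u k by auto
  qed
  then obtain par where par: "\<And>v. v \<in> {2..n} \<Longrightarrow> par v \<in> {1..n} \<and> {par v, v} \<in> E \<and> d (par v) < d v"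
    by metis
  let ?F = "(\<lambda>v. {par v, v}) ` {2..n}"
  \<comment> \<open>If two vertices had the same parent edge, each would be the parent of the other,
    against the strict descent of \<open>d\<close>.\<close>
  have "inj_on (\<lambda>v. {par v, v}) {2..n}"
  proof (rule inj_onI)
    fix u v
    assume uv: "u \<in> {2..n}" "v \<in> {2..n}" "{par u, u} = {par v, v}"
    show "u = v"
    proof (rule ccontr)
      assume "u \<noteq> v"
      with uv(3) have "par u = v" "par v = u" by (auto simp: doubleton_eq_iff)
      with par[OF uv(1)] par[OF uv(2)] show False by simp
    qed
  qed
  then have card: "card ?F = n - 1"
    by (simp add: card_image)
  have root: "(1, v) \<in> (adj ?F)\<^sup>*" if "v \<in> {1..n}" for v
    using that
  proof (induction "d v" arbitrary: v rule: less_induct)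
    case less
    show ?case
    proof (cases "v = 1")
      case False
      with less.prems have v: "v \<in> {2..n}" by auto
      then have "(1, par v) \<in> (adj ?F)\<^sup>*"
        using less.hyps par by auto
      moreover have "(par v, v) \<in> adj ?F"
        using v by auto
      ultimately show ?thesis by (rule rtrancl_into_rtrancl)
    qed auto
  qed
  have "graph_connected {1..n} ?F"
    unfolding graph_connected_def
  proof (intro ballI)
    fix u v
    assume uv: "u \<in> {1..n}" "v \<in> {1..n}"
    show "(u, v) \<in> (adj ?F)\<^sup>*"
      using adj_rtrancl_sym[OF root[OF uv(1)]] root[OF uv(2)] by (rule rtrancl_trans)
  qed
  moreover have "?F \<subseteq> E"
    using par by auto
  ultimately show ?thesis
    using that card by blast
qed

lemma graph_connected_card:
  assumes "graph_connected {1..n} E" "E \<subseteq> complete_edges n" "n \<ge> 1"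
  shows "n - 1 \<le> card E"
proof -
  obtain F where "F \<subseteq> E" "card F = n - 1"
    using graph_connected_parent_edges[OF assms] by blast
  then show ?thesis
    using card_mono[OF finite_subset[OF assms(2) finite_complete_edges]] by metis
qed

lemma rtrancl_distinct_path:
  assumes "(x, y) \<in> r\<^sup>*"
  obtains p where "p \<noteq> []" "hd p = x" "last p = y" "distinct p"
    "\<And>i. Suc i < length p \<Longrightarrow> (p ! i, p ! Suc i) \<in> r"
proof -
  have "\<exists>p. p \<noteq> [] \<and> hd p = x \<and> last p = y \<and> distinct p \<and> successively (\<lambda>a b. (a, b) \<in> r) p"
    using assms
  proof (induction rule: converse_rtrancl_induct)
    case base
    show ?case by (rule exI[of _ "[y]"]) auto
  next
    case (step x z)
    then obtain p where p: "p \<noteq> []" "hd p = z" "last p = y" "distinct p"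
      "successively (\<lambda>a b. (a, b) \<in> r) p" by blast
    show ?case
    proof (cases "x \<in> set p")
      case False
      with p step show ?thesis
        by (intro exI[of _ "x # p"]) (auto simp: successively_Cons)
    next
      \<comment> \<open>A repeated start vertex is a loop: only the tail from its occurrence in
        \<open>p\<close> is kept.\<close>
      case True
      then obtain us vs where "p = us @ x # vs"
        by (auto simp: in_set_conv_decomp)
      with p show ?thesis
        by (intro exI[of _ "x # vs"]) (auto simp: successively_append_iff)
    qed
  qed
  then show ?thesis
    using that by (auto simp: successively_conv_nth)
qed

text \<open>A detour from \<open>a\<close> to \<open>b\<close> can be taken without repeated
  vertices; the deleted edge then closes it to a forbidden cycle.\<close>

lemma acyclic_bridge:
  assumes "graph_acyclic E" "{a, b} \<in> E" "a \<noteq> b"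
  shows "(a, b) \<notin> (adj (E - {{a, b}}))\<^sup>*"
proof
  assume "(a, b) \<in> (adj (E - {{a, b}}))\<^sup>*"
  then obtain p where p: "p \<noteq> []" "hd p = a" "last p = b" "distinct p"
    "\<And>i. Suc i < length p \<Longrightarrow> (p ! i, p ! Suc i) \<in> adj (E - {{a, b}})"
    by (rule rtrancl_distinct_path) blast
  have ab: "p ! 0 = a" "p ! (length p - 1) = b"
    using p by (auto simp: hd_conv_nth last_conv_nth)
  \<comment> \<open>Length 1 would force \<open>a = b\<close>, and length 2 would use the deleted
    edge; \<open>graph_acyclic\<close> only excludes cycles with at least 3 vertices.\<close>
  have "length p \<noteq> 1"
    using ab assms(3) by auto
  moreover have "length p \<noteq> 2"
    using ab p(5)[of 0] by auto
  ultimately have "length p \<ge> 3"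
    using p(1) by (cases "length p") auto
  moreover have "{p ! i, p ! (Suc i mod length p)} \<in> E" if "i < length p" for i
  proof (cases "Suc i = length p")
    case True
    then have "i = length p - 1" by simp
    with True show ?thesis
      using ab assms(2) by (simp add: insert_commute)
  next
    case False
    with that show ?thesis
      using p(5)[of i] by simp
  qed
  ultimately show False
    using assms(1) p(4) unfolding graph_acyclic_def by blast
qed

lemma edge_subset_cases:
  assumes "e \<in> complete_edges n"
  obtains a b where "e = {a, b}" "a \<in> {1..n}" "b \<in> {1..n}" "a \<noteq> b"
  using assms unfolding complete_edges_def by blast

text \<open>Forward, the parent edges already connect all vertices, so a further edge of
  \<open>E\<close> would not be a bridge. Backward, deleting one edge of a cycle would leave a
  connected graph with fewer than \<open>n - 1\<close> edges.\<close>

lemma spanning_trees_eq: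
  assumes n: "n \<ge> 1"
  shows "spanning_trees n = {E. E \<subseteq> complete_edges n \<and> graph_connected {1..n} E \<and> card E = n - 1}"
proof (intro subset_antisym subsetI)
  fix E
  assume "E \<in> spanning_trees n"
  then have E: "E \<subseteq> complete_edges n" "graph_connected {1..n} E" "graph_acyclic E"
    unfolding spanning_trees_def by blast+
  obtain F where F: "F \<subseteq> E" "graph_connected {1..n} F" "card F = n - 1"
    using graph_connected_parent_edges[OF E(2,1) n] .
  have "F = E"
  proof (rule ccontr)
    assume "F \<noteq> E"
    with F obtain e where e: "e \<in> E" "e \<notin> F" by blast
    obtain a b where ab: "e = {a, b}" "a \<in> {1..n}" "b \<in> {1..n}" "a \<noteq> b"
      using e E edge_subset_cases by blast
    have "(a, b) \<in> (adj F)\<^sup>*"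
      using F ab by (auto simp: graph_connected_def)
    also have "\<dots> \<subseteq> (adj (E - {{a, b}}))\<^sup>*"
      using F e ab by (intro rtrancl_mono) auto
    finally show False
      using acyclic_bridge[OF E(3), of a b] e ab by auto
  qed
  with F E show "E \<in> {E. E \<subseteq> complete_edges n \<and> graph_connected {1..n} E \<and> card E = n - 1}"
    by auto
next
  fix E
  assume "E \<in> {E. E \<subseteq> complete_edges n \<and> graph_connected {1..n} E \<and> card E = n - 1}"
  then have E: "E \<subseteq> complete_edges n" "graph_connected {1..n} E" "card E = n - 1" by auto
  have finE: "finite E"
    by (rule finite_subset[OF E(1) finite_complete_edges])
  have "graph_acyclic E"
    unfolding graph_acyclic_def
  proof (intro notI, elim exE conjE)
    fix vs
    assume vs: "distinct vs" "3 \<le> length vs" "\<forall>i<length vs. {vs ! i, vs ! (Suc i mod length vs)} \<in> E"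
    define m where "m = length vs - 1"
    have m: "length vs = Suc m" "m \<ge> 2"
      using vs(2) by (auto simp: m_def)
    let ?e = "{vs ! m, vs ! 0}"
    let ?F = "E - {?e}"
    \<comment> \<open>Distinctness and \<open>m \<ge> 2\<close> keep the remaining cycle edges
      different from the deleted one.\<close>
    have edge: "{vs ! i, vs ! Suc i} \<in> ?F" if "i < m" for i
    proof -
      have "{vs ! i, vs ! Suc i} \<in> E"
        using vs(3) m that by (metis Suc_less_eq less_Suc_eq mod_less)
      moreover have "vs ! i \<noteq> vs ! m" "i \<noteq> 0 \<Longrightarrow> vs ! i \<noteq> vs ! 0" "vs ! Suc i \<noteq> vs ! 0"
        "Suc i \<noteq> m \<Longrightarrow> vs ! Suc i \<noteq> vs ! m"
        using vs(1) m that by (auto simp: nth_eq_iff_index_eq)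
      ultimately show ?thesis
        using m by (cases "i = 0") (auto simp: doubleton_eq_iff)
    qed
    have "(vs ! 0, vs ! i) \<in> (adj ?F)\<^sup>*" if "i \<le> m" for i
      using that
    proof (induction i)
      case (Suc i)
      then have "(vs ! i, vs ! Suc i) \<in> adj ?F"
        using edge[of i] by auto
      with Suc show ?case
        by (meson Suc_leD rtrancl.rtrancl_into_rtrancl)
    qed auto
    from this[of m] have "(vs ! 0, vs ! m) \<in> (adj ?F)\<^sup>*" by simp
    note detour = this adj_rtrancl_sym[OF this]
    have "adj E \<subseteq> (adj ?F)\<^sup>*"
      using detour by (auto simp: doubleton_eq_iff)
    then have "(adj E)\<^sup>* \<subseteq> (adj ?F)\<^sup>*"
      by (rule rtrancl_subset_rtrancl)
    then have "graph_connected {1..n} ?F"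
      using E(2) unfolding graph_connected_def by blast
    then have "n - 1 \<le> card ?F"
      using E(1) n by (intro graph_connected_card) auto
    moreover have "?e \<in> E"
      using vs(3)[rule_format, of m] m by simp
    then have "card ?F < card E"
      using finE by (intro psubset_card_mono) auto
    ultimately show False
      using E(3) by simp
  qed
  with E show "E \<in> spanning_trees n"
    unfolding spanning_trees_def by blast
qed

text \<open>Deleting \<open>e\<close> splits the tree. Summing the relation over the component
  \<open>C\<close> of \<open>s e\<close> cancels every other edge, since both of its ends lie on the
  same side, and leaves \<open>c e\<close>.\<close>

lemma spanning_tree_edges_independent:
  fixes c :: "nat set \<Rightarrow> 'a::comm_ring_1" and s t :: "nat set \<Rightarrow> nat"
  assumes "E \<in> spanning_trees n" "D \<subseteq> E"
    and ends: "\<And>e. e \<in> D \<Longrightarrow> e = {s e, t e} \<and> s e \<noteq> t e"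
    and zero: "\<And>i. i \<in> {1..n} \<Longrightarrow> (\<Sum>e\<in>D. c e * (of_bool (i = s e) - of_bool (i = t e))) = 0"
    and e: "e \<in> D"
  shows "c e = 0"
proof -
  have E: "E \<subseteq> complete_edges n" "graph_acyclic E"
    using assms(1) unfolding spanning_trees_def by blast+
  have finD: "finite D"
    by (rule finite_subset[OF order_trans[OF assms(2) E(1)] finite_complete_edges])
  define C where "C = {x\<in>{1..n}. (s e, x) \<in> (adj (E - {e}))\<^sup>*}"
  have ver: "s f \<in> {1..n}" "t f \<in> {1..n}" if "f \<in> D" for f
    using that ends[OF that] E(1) assms(2) complete_edges_Pow by blast+
  have other: "s f \<in> C \<longleftrightarrow> t f \<in> C" if "f \<in> D" "f \<noteq> e" for f
  proof -
    have "f = {s f, t f}"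
      using ends[OF that(1)] by simp
    then have "(s f, t f) \<in> adj (E - {e})" "(t f, s f) \<in> adj (E - {e})"
      using that assms(2) by (auto simp: insert_commute)
    then show ?thesis
      using ver[OF that(1)] unfolding C_def by (auto intro: rtrancl_into_rtrancl)
  qed
  have bridge: "s e \<in> C" "t e \<notin> C"
  proof -
    show "s e \<in> C" using ver[OF e] by (auto simp: C_def)
    have "{s e, t e} = e" "s e \<noteq> t e"
      using ends[OF e] by auto
    then show "t e \<notin> C"
      using acyclic_bridge[OF E(2), of "s e" "t e"] e assms(2) by (auto simp: C_def)
  qed
  have "0 = (\<Sum>i\<in>C. \<Sum>f\<in>D. c f * (of_bool (i = s f) - of_bool (i = t f)))"
    by (rule sum.neutral[symmetric]) (auto simp: C_def zero)
  also have "\<dots> = (\<Sum>f\<in>D. \<Sum>i\<in>C. c f * (of_bool (i = s f) - of_bool (i = t f)))"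
    by (rule sum.swap)
  also have "\<dots> = (\<Sum>f\<in>D. c f * (of_bool (s f \<in> C) - of_bool (t f \<in> C)))"
  proof (intro sum.cong refl)
    fix f
    have "finite C" by (simp add: C_def)
    then have "(\<Sum>i\<in>C. of_bool (i = x)) = (of_bool (x \<in> C) :: 'a)" for x
      by (simp add: of_bool_def)
    then show "(\<Sum>i\<in>C. c f * (of_bool (i = s f) - of_bool (i = t f))) =
        c f * (of_bool (s f \<in> C) - of_bool (t f \<in> C))"
      by (simp add: sum_distrib_left[symmetric] sum_subtractf)
  qed
  also have "\<dots> = (\<Sum>f\<in>{e}. c f * (of_bool (s f \<in> C) - of_bool (t f \<in> C)))"
    by (rule sum.mono_neutral_right) (use finD e other in auto)
  finally show ?thesis
    using bridge by simp
qed

section \<open>Products of transpositions\<close>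

definition edge_transp :: "nat set \<Rightarrow> nat \<Rightarrow> nat" where
  "edge_transp e = transpose (Min e) (Max e)"

text \<open>The signed incidence vector of the edge. Its orientation by \<open>Min\<close> and
  \<open>Max\<close> is an arbitrary choice, which cancels in the products
  \<open>edge_vec e i * edge_vec e j\<close>.\<close>

definition edge_vec :: "nat set \<Rightarrow> nat \<Rightarrow> 'a::comm_ring_1" where
  "edge_vec e i = of_bool (i = Min e) - of_bool (i = Max e)"

definition edge_list_prod :: "nat set list \<Rightarrow> nat \<Rightarrow> nat" where
  "edge_list_prod es = fold (\<circ>) (map edge_transp es) id"

lemma edge_list_prod_Nil [simp]: "edge_list_prod [] = id"
  by (simp add: edge_list_prod_def)

lemma edge_list_prod_Cons [simp]: "edge_list_prod (e # es) = edge_list_prod es \<circ> edge_transp e"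
proof -
  have "fold (\<circ>) ts f = fold (\<circ>) ts id \<circ> f" for ts and f :: "nat \<Rightarrow> nat"
  proof (induction ts arbitrary: f)
    case (Cons t ts)
    show ?case
      using Cons[of "t \<circ> f"] Cons[of t] by (simp add: comp_assoc)
  qed simp
  from this[of _ "edge_transp e"] show ?thesis
    by (simp add: edge_list_prod_def)
qed

lemma edge_list_prod_snoc: "edge_list_prod (es @ [e]) = edge_transp e \<circ> edge_list_prod es"
  by (simp add: edge_list_prod_def)

lemma edge_ends:
  assumes "e \<in> complete_edges n"
  shows "e = {Min e, Max e}" "Min e \<in> {1..n}" "Max e \<in> {1..n}" "Min e < Max e"
proof -
  obtain a b where ab: "e = {a, b}" "a \<in> {1..n}" "b \<in> {1..n}" "a \<noteq> b"
    using assms by (rule edge_subset_cases)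
  have "Min e = min a b" "Max e = max a b"
    using ab by auto
  with ab show "e = {Min e, Max e}" "Min e \<in> {1..n}" "Max e \<in> {1..n}" "Min e < Max e"
    by (auto simp: min_def max_def)
qed

lemma edge_transp_support:
  assumes "e \<in> complete_edges n"
  shows "{x. edge_transp e x \<noteq> x} = e"
proof -
  have "{x. edge_transp e x \<noteq> x} = {Min e, Max e}"
    using edge_ends(4)[OF assms] by (auto simp: edge_transp_def transpose_def)
  then show ?thesis
    using edge_ends(1)[OF assms] by simp
qed

lemma edge_transp_permutes: "e \<in> complete_edges n \<Longrightarrow> edge_transp e permutes {1..n}"
  unfolding edge_transp_def using edge_ends by (intro permutes_swap_id) auto

lemma edge_list_prod_permutes: "set es \<subseteq> complete_edges n \<Longrightarrow> edge_list_prod es permutes {1..n}"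
proof (induction es)
  case (Cons e es)
  then show ?case
    unfolding edge_list_prod_Cons by (intro permutes_compose edge_transp_permutes) auto
qed (simp add: permutes_id)

lemma transpositions_eq: "transpositions n = edge_transp ` complete_edges n"
proof (intro subset_antisym subsetI)
  fix \<tau>
  assume "\<tau> \<in> transpositions n"
  then obtain i j where ij: "\<tau> = transpose i j" "i \<in> {1..n}" "j \<in> {1..n}" "i \<noteq> j"
    by (auto simp: transpositions_def)
  have "edge_transp {i, j} = \<tau>"
    using ij by (auto simp: edge_transp_def min_def max_def transpose_commute)
  moreover have "{i, j} \<in> complete_edges n"
    using ij by (auto simp: complete_edges_def)
  ultimately show "\<tau> \<in> edge_transp ` complete_edges n"
    by (rule image_eqI[OF sym])
next
  fix \<tau>
  assume "\<tau> \<in> edge_transp ` complete_edges n"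
  then obtain e where e: "\<tau> = edge_transp e" "e \<in> complete_edges n" by blast
  have "\<tau> = transpose (Min e) (Max e)" "Min e \<noteq> Max e"
    using e edge_ends(4)[OF e(2)] by (auto simp: edge_transp_def)
  with edge_ends(2,3)[OF e(2)] show "\<tau> \<in> transpositions n"
    unfolding transpositions_def by blast
qed

lemma inj_on_edge_transp: "inj_on edge_transp (complete_edges n)"
proof (rule inj_onI)
  fix d e
  assume de: "d \<in> complete_edges n" "e \<in> complete_edges n" and eq: "edge_transp d = edge_transp e"
  show "d = e"
    using edge_transp_support[OF de(1)] unfolding eq edge_transp_support[OF de(2)] by (rule sym)
qed

text \<open>A transposition acts on functions as the reflection in its edge vector.\<close>

lemma transposed_value:
  fixes f :: "nat \<Rightarrow> 'a::comm_ring_1"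
  shows "f (edge_transp e x) = f x - (f (Min e) - f (Max e)) * edge_vec e x"
  by (cases "Min e = Max e") (auto simp: edge_transp_def edge_vec_def transpose_def)

text \<open>Unrolls the reflections: \<open>c e\<close> is the increment along \<open>e\<close> of
  \<open>f\<close> composed with the factors after \<open>e\<close>. Distinctness gives each edge a
  single coefficient.\<close>

lemma transposition_product_value:
  fixes f :: "nat \<Rightarrow> 'a::comm_ring_1"
  assumes "distinct es"
  shows "\<exists>c. \<forall>x. f (edge_list_prod es x) = f x - (\<Sum>e\<in>set es. c e * edge_vec e x)"
  using assms
proof (induction es)
  case Nil
  show ?case by simp
next
  case (Cons d es)
  then obtain c where c: "\<And>x. f (edge_list_prod es x) = f x - (\<Sum>e\<in>set es. c e * edge_vec e x)"
    by auto
  let ?h = "\<lambda>x. f (edge_list_prod es x)"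
  let ?c = "c(d := ?h (Min d) - ?h (Max d))"
  have "f (edge_list_prod (d # es) x) = f x - (\<Sum>e\<in>set (d # es). ?c e * edge_vec e x)" for x
  proof -
    have "(\<Sum>e\<in>set es. ?c e * edge_vec e x) = (\<Sum>e\<in>set es. c e * edge_vec e x)"
      using Cons.prems by (intro sum.cong) auto
    then have "(\<Sum>e\<in>set (d # es). ?c e * edge_vec e x) =
        (?h (Min d) - ?h (Max d)) * edge_vec d x + (\<Sum>e\<in>set es. c e * edge_vec e x)"
      using Cons.prems by simp
    then show ?thesis
      using transposed_value[of ?h d x] c[of x] by simp
  qed
  then show ?case by blast
qed

text \<open>If \<open>f\<close> is invariant under the product, then the increments of \<open>f\<close> along the successive
  factors form a vanishing combination of the linearly independent edge vectors.\<close>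

lemma tree_product_invariant:
  fixes f :: "nat \<Rightarrow> 'a::comm_ring_1"
  assumes "E \<in> spanning_trees n" "distinct es" "set es \<subseteq> E"
    and "\<And>x. x \<in> {1..n} \<Longrightarrow> f (edge_list_prod es x) = f x"
    and "e \<in> set es"
  shows "f (Min e) = f (Max e)"
  using assms(2-)
proof (induction es rule: rev_induct)
  case (snoc d es)
  have E: "E \<subseteq> complete_edges n"
    using assms(1) unfolding spanning_trees_def by blast
  obtain c where c: "\<And>x. f (edge_transp d (edge_list_prod es x)) =
      f (edge_transp d x) - (\<Sum>e\<in>set es. c e * edge_vec e x)"
    using transposition_product_value[of es "\<lambda>x. f (edge_transp d x)"] snoc.prems(1) by auto
  let ?c = "c(d := f (Min d) - f (Max d))"
  have "(\<Sum>e\<in>set (es @ [d]). ?c e * (of_bool (x = Min e) - of_bool (x = Max e))) = 0"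
    if x: "x \<in> {1..n}" for x
  proof -
    have "(\<Sum>e\<in>set es. ?c e * edge_vec e x) = (\<Sum>e\<in>set es. c e * edge_vec e x)"
      using snoc.prems(1) by (intro sum.cong) auto
    then have "(\<Sum>e\<in>set (es @ [d]). ?c e * edge_vec e x) =
        (f (Min d) - f (Max d)) * edge_vec d x + (\<Sum>e\<in>set es. c e * edge_vec e x)"
      using snoc.prems(1) by simp
    also have "\<dots> = f x - f (edge_list_prod (es @ [d]) x)"
      using c[of x] transposed_value[of f d x] by (simp add: edge_list_prod_snoc)
    also have "\<dots> = 0"
      using snoc.prems(3)[OF x] by simp
    finally show ?thesis
      unfolding edge_vec_def .
  qed
  moreover have "a = {Min a, Max a} \<and> Min a \<noteq> Max a" if "a \<in> set (es @ [d])" for a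
  proof -
    have "a \<in> complete_edges n"
      using that snoc.prems(2) E by blast
    from edge_ends[OF this] show ?thesis by simp
  qed
  ultimately have "?c d = 0"
    using spanning_tree_edges_independent[OF assms(1) snoc.prems(2), of Min Max ?c d] by simp
  then have d: "f (Min d) = f (Max d)"
    by simp
  show ?case
  proof (cases "e = d")
    case False
    have "f (edge_list_prod es x) = f x" if "x \<in> {1..n}" for x
      using snoc.prems(3)[OF that] transposed_value[of f d] d by (simp add: edge_list_prod_snoc)
    then show ?thesis
      using snoc False by auto
  qed (use d in simp)
qed simp

section \<open>Full cycles\<close>

lemma full_cycle_invariant_const:
  assumes "is_full_cycle n \<sigma>" "\<And>x. x \<in> {1..n} \<Longrightarrow> f (\<sigma> x) = f x"
    and "x \<in> {1..n}" "y \<in> {1..n}"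
  shows "f x = f y"
proof -
  obtain cs where cs: "cycle cs" "set cs = {1..n}" "\<sigma> = cycle_of_list cs"
    using assms(1) by (auto simp: is_full_cycle_def)
  have "f (cs ! k) = f (cs ! 0)" if k: "k < length cs" for k
  proof -
    have "0 < length cs"
      using k by linarith
    then have "map (\<sigma> ^^ k) cs ! 0 = rotate k cs ! 0"
      using cyclic_rotation[OF cs(1), of k] cs(3) by simp
    then have "(\<sigma> ^^ k) (cs ! 0) = cs ! k"
      using k \<open>0 < length cs\<close> by (simp add: nth_rotate)
    moreover have "(\<sigma> ^^ j) (cs ! 0) \<in> {1..n} \<and> f ((\<sigma> ^^ j) (cs ! 0)) = f (cs ! 0)" for j
    proof (induction j)
      case 0
      then show ?case
        using \<open>0 < length cs\<close> cs(2) nth_mem by fastforce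
    next
      case (Suc j)
      have "\<sigma> permutes {1..n}"
        using cycle_permutes[of cs] cs by simp
      then show ?case
        using Suc assms(2) permutes_in_image[of \<sigma> "{1..n}"] by auto
    qed
    ultimately show ?thesis by metis
  qed
  then show ?thesis
    using assms(3,4) cs(2) by (metis in_set_conv_nth)
qed

text \<open>The test function is the indicator of the orbit of 1. The value type is left open: trees
  use integers, determinants complex numbers.\<close>

lemma full_cycleI:
  assumes \<sigma>: "\<sigma> permutes {1..n}" and n: "n \<ge> 1"
    and const: "\<And>f :: nat \<Rightarrow> 'a::zero_neq_one. (\<And>x. x \<in> {1..n} \<Longrightarrow> f (\<sigma> x) = f x) \<Longrightarrow>
      (\<And>x. x \<in> {1..n} \<Longrightarrow> f x = f 1)"
  shows "is_full_cycle n \<sigma>"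
proof -
  let ?cs = "support \<sigma> 1"
  have perm: "permutation \<sigma>"
    using \<sigma> by (auto simp: permutation_permutes)
  have cs: "set ?cs = range (\<lambda>k. (\<sigma> ^^ k) 1)"
    using support_set[OF perm] .
  have sub: "set ?cs \<subseteq> {1..n}"
  proof -
    have "(\<sigma> ^^ k) 1 \<in> {1..n}" for k
      using n permutes_in_image[OF \<sigma>] by (induction k) auto
    then show ?thesis unfolding cs by blast
  qed
  have "of_bool (\<sigma> x \<in> set ?cs) = (of_bool (x \<in> set ?cs) :: 'a)" for x
  proof -
    have "x \<in> set ?cs" if x: "\<sigma> x \<in> set ?cs"
    proof -
      obtain k where k: "\<sigma> x = (\<sigma> ^^ k) 1"
        using x unfolding cs by blast
      \<comment> \<open>Finite order supplies a predecessor in the orbit even when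
        \<open>k = 0\<close>.\<close>
      obtain m where "m > 0" "\<sigma> ^^ m = id"
        using permutation_is_nilpotent[OF perm] by metis
      then have "(\<sigma> ^^ (k + m)) 1 = (\<sigma> ^^ k) 1"
        by (simp add: funpow_add)
      with \<open>m > 0\<close> have "\<sigma> ((\<sigma> ^^ (k + m - 1)) 1) = \<sigma> x"
        using k by (cases m) auto
      then have "x = (\<sigma> ^^ (k + m - 1)) 1"
        using permutes_inj[OF \<sigma>] by (auto dest: injD)
      then show ?thesis unfolding cs by blast
    qed
    moreover have "\<sigma> x \<in> set ?cs" if x: "x \<in> set ?cs"
    proof -
      obtain k where "x = (\<sigma> ^^ k) 1"
        using x unfolding cs by blast
      then have "\<sigma> x = (\<sigma> ^^ Suc k) 1" by simp
      then show ?thesis unfolding cs by blast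
    qed
    ultimately have "\<sigma> x \<in> set ?cs \<longleftrightarrow> x \<in> set ?cs" by blast
    then show ?thesis by simp
  qed
  then have "of_bool (x \<in> set ?cs) = (of_bool (1 \<in> set ?cs) :: 'a)" if "x \<in> {1..n}" for x
    using const[of "\<lambda>x. of_bool (x \<in> set ?cs)" x] that by blast
  then have "x \<in> set ?cs \<longleftrightarrow> 1 \<in> set ?cs" if "x \<in> {1..n}" for x
    using that by (simp only: of_bool_eq_iff)
  moreover have "1 \<in> set ?cs"
    unfolding cs by (rule range_eqI[of _ _ 0]) simp
  ultimately have set_cs: "set ?cs = {1..n}"
    using sub by blast
  have "\<sigma> = cycle_of_list ?cs"
  proof
    fix x
    show "\<sigma> x = cycle_of_list ?cs x"
    proof (cases "x \<in> {1..n}")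
      case True
      then show ?thesis
        unfolding set_cs[symmetric] by (rule cycle_restrict[OF perm])
    next
      case False
      then show ?thesis
        using permutes_not_in[OF \<sigma>] id_outside_supp[of x ?cs] unfolding set_cs by metis
    qed
  qed
  then show ?thesis
    unfolding is_full_cycle_def using cycle_of_permutation[OF perm] set_cs by blast
qed

section \<open>Minimal factorizations and spanning trees\<close>

lemma connected_const:
  assumes "graph_connected {1..n} E" "\<And>x y. {x, y} \<in> E \<Longrightarrow> f x = f y"
    and "x \<in> {1..n}" "y \<in> {1..n}"
  shows "f x = f y"
proof -
  have "(x, y) \<in> (adj E)\<^sup>*"
    using assms by (auto simp: graph_connected_def)
  then show ?thesis
    by (induction rule: rtrancl_induct) (auto simp: assms(2))
qed

text \<open>Forward, reachability from \<open>x\<close> is invariant under each factor, so a full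
  cycle makes the edges connect all vertices; \<open>n - 1\<close> of them must then be distinct.
  Backward, a function invariant under the product is constant along every tree edge, hence
  constant.\<close>

lemma full_cycle_product_iff_tree:
  assumes n: "n \<ge> 1" and es: "set es \<subseteq> complete_edges n" "length es = n - 1"
  shows "is_full_cycle n (edge_list_prod es) \<longleftrightarrow> distinct es \<and> set es \<in> spanning_trees n"
proof
  assume cyc: "is_full_cycle n (edge_list_prod es)"
  have "(x, y) \<in> (adj (set es))\<^sup>*" if "x \<in> {1..n}" "y \<in> {1..n}" for x y
  proof -
    let ?f = "\<lambda>z. (x, z) \<in> (adj (set es))\<^sup>*"
    have step: "?f (edge_transp e z) = ?f z" if e: "e \<in> set es" for e z
    proof (cases "edge_transp e z = z")
      case False
      then have "z \<in> {Min e, Max e}"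
        by (auto simp: edge_transp_def transpose_def split: if_splits)
      then have "{z, edge_transp e z} = {Min e, Max e}"
        by (auto simp: edge_transp_def transpose_def split: if_splits)
      then have "{z, edge_transp e z} = e"
        using edge_ends(1)[of e n] e es by auto
      then have "(z, edge_transp e z) \<in> adj (set es)" "(edge_transp e z, z) \<in> adj (set es)"
        using e by (auto simp: insert_commute)
      then show ?thesis
        by (blast intro: rtrancl_into_rtrancl)
    qed simp
    have "?f (edge_list_prod ds z) = ?f z" if "set ds \<subseteq> set es" for ds z
      using that by (induction ds arbitrary: z) (use step in auto)
    then have "?f x = ?f y"
      using full_cycle_invariant_const[OF cyc, of ?f x y] that by blast
    then show ?thesis by simp
  qed
  then have con: "graph_connected {1..n} (set es)"
    by (auto simp: graph_connected_def)
  then have "n - 1 \<le> card (set es)"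
    using graph_connected_card es(1) n by blast
  then have card: "card (set es) = n - 1"
    using card_length[of es] es(2) by simp
  then show "distinct es \<and> set es \<in> spanning_trees n"
    using con es n by (auto simp: card_distinct spanning_trees_eq)
next
  assume tree: "distinct es \<and> set es \<in> spanning_trees n"
  show "is_full_cycle n (edge_list_prod es)"
  proof (rule full_cycleI[OF edge_list_prod_permutes[OF es(1)] n, where 'a = int])
    fix f :: "nat \<Rightarrow> int" and x
    assume inv: "\<And>x. x \<in> {1..n} \<Longrightarrow> f (edge_list_prod es x) = f x" and x: "x \<in> {1..n}"
    have "f a = f b" if ab: "{a, b} \<in> set es" for a b
    proof -
      have "f (Min {a, b}) = f (Max {a, b})"
        using tree_product_invariant[of "set es" n es f "{a, b}"] tree inv ab by auto
      then show ?thesis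
        by (auto simp: min_def max_def split: if_splits)
    qed
    then show "f x = f 1"
      using connected_const[of n "set es" f x 1] tree x n
      unfolding spanning_trees_def by auto
  qed
qed

lemma sum_full_cycle_products_genus_0:
  assumes n: "n \<ge> 1"
  shows "(\<Sum>es | set es \<subseteq> complete_edges n \<and> length es = n - 1 \<and> is_full_cycle n (edge_list_prod es).
      prod_list (map x es)) = of_nat (fact (n - 1)) * (\<Sum>E\<in>spanning_trees n. \<Prod>e\<in>E. x e :: 'a::comm_semiring_1)"
proof -
  have tree: "finite E" "E \<subseteq> complete_edges n" "card E = n - 1" if "E \<in> spanning_trees n" for E
    using that n finite_subset[OF _ finite_complete_edges] by (auto simp: spanning_trees_eq)
  have "{es. set es \<subseteq> complete_edges n \<and> length es = n - 1 \<and> is_full_cycle n (edge_list_prod es)} =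
      (\<Union>E\<in>spanning_trees n. permutations_of_set E)"
  proof (intro subset_antisym subsetI)
    fix es
    assume "es \<in> {es. set es \<subseteq> complete_edges n \<and> length es = n - 1 \<and> is_full_cycle n (edge_list_prod es)}"
    then show "es \<in> (\<Union>E\<in>spanning_trees n. permutations_of_set E)"
      using full_cycle_product_iff_tree[OF n, of es] by (auto simp: permutations_of_set_def)
  next
    fix es
    assume "es \<in> (\<Union>E\<in>spanning_trees n. permutations_of_set E)"
    then have es: "set es \<in> spanning_trees n" "distinct es"
      by (auto simp: permutations_of_set_def)
    have "length es = n - 1"
      using tree(3)[OF es(1)] distinct_card[OF es(2)] by simp
    then show "es \<in> {es. set es \<subseteq> complete_edges n \<and> length es = n - 1 \<and> is_full_cycle n (edge_list_prod es)}"
      using full_cycle_product_iff_tree[OF n, of es] es tree(2)[OF es(1)] by simp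
  qed
  then have "(\<Sum>es | set es \<subseteq> complete_edges n \<and> length es = n - 1 \<and> is_full_cycle n (edge_list_prod es).
      prod_list (map x es)) = (\<Sum>E\<in>spanning_trees n. \<Sum>es\<in>permutations_of_set E. prod_list (map x es))"
    using tree(1)
    by (simp only:) (intro sum.UNION_disjoint finite_spanning_trees ballI finite_permutations_of_set,
      auto simp: permutations_of_set_def)
  also have "\<dots> = (\<Sum>E\<in>spanning_trees n. of_nat (fact (n - 1)) * (\<Prod>e\<in>E. x e))"
  proof (rule sum.cong[OF refl])
    fix E
    assume E: "E \<in> spanning_trees n"
    have "(\<Sum>es\<in>permutations_of_set E. prod_list (map x es)) = (\<Sum>es\<in>permutations_of_set E. \<Prod>e\<in>E. x e)"
      by (intro sum.cong refl) (auto simp: permutations_of_set_def prod.distinct_set_conv_list)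
    then show "(\<Sum>es\<in>permutations_of_set E. prod_list (map x es)) = of_nat (fact (n - 1)) * (\<Prod>e\<in>E. x e)"
      using tree[OF E] by simp
  qed
  finally show ?thesis
    by (simp add: sum_distrib_left)
qed

section \<open>Permutation matrices\<close>

text \<open>The basis vector of \<open>j\<close> goes to that of \<open>\<sigma> j\<close>, so that
  matrix products follow composition. \<open>Suc\<close> matches indices from 0 with vertices from
  1.\<close>

definition pmat :: "(nat \<Rightarrow> nat) \<Rightarrow> nat \<Rightarrow> nat \<Rightarrow> 'a::comm_ring_1" where
  "pmat \<sigma> i j = of_bool (Suc i = \<sigma> (Suc j))"

lemma permutes_Suc_image:
  assumes "\<sigma> permutes {1..n}" "j < n"
  obtains k where "k < n" "\<sigma> (Suc j) = Suc k"
proof -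
  have "Suc j \<in> {1..n}"
    using assms(2) by simp
  then have "\<sigma> (Suc j) \<in> {1..n}"
    by (simp only: permutes_in_image[OF assms(1)])
  then show ?thesis
    using that[of "\<sigma> (Suc j) - 1"] by auto
qed

lemma permutes_Suc_preimage:
  assumes "\<sigma> permutes {1..n}" "i < n"
  obtains k where "k < n" "Suc i = \<sigma> (Suc k)"
proof -
  obtain k where "k < n" "Hilbert_Choice.inv \<sigma> (Suc i) = Suc k"
    using permutes_Suc_image[OF permutes_inv[OF assms(1)] assms(2)] .
  then show ?thesis
    using that[of k] permutes_inverses(1)[OF assms(1)] by metis
qed

lemma pmat_mmul_right:
  assumes "\<sigma> permutes {1..n}" "j < n" "k < n" "\<sigma> (Suc j) = Suc k"
  shows "mmul n f (pmat \<sigma>) i j = f i k"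
proof -
  have "mmul n f (pmat \<sigma>) i j = (\<Sum>l<n. if l = k then f i l else 0)"
    unfolding mmul_def pmat_def by (intro sum.cong) (auto simp: assms(4))
  then show ?thesis
    using assms(3) by simp
qed

lemma pmat_mmul_left:
  assumes "\<sigma> permutes {1..n}" "i < n" "k < n" "Suc i = \<sigma> (Suc k)"
  shows "mmul n (pmat \<sigma>) f i j = f k j"
proof -
  have "mmul n (pmat \<sigma>) f i j = (\<Sum>l<n. if l = k then f l j else 0)"
    unfolding mmul_def pmat_def assms(4)
    using permutes_inj[OF assms(1)] by (intro sum.cong) (auto dest: injD)
  then show ?thesis
    using assms(3) by simp
qed

lemma mmul_pmat:
  assumes "\<sigma> permutes {1..n}" "\<rho> permutes {1..n}" "i < n" "j < n"
  shows "mmul n (pmat \<sigma>) (pmat \<rho>) i j = (pmat (\<sigma> \<circ> \<rho>) i j :: 'a::comm_ring_1)"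
proof -
  obtain k where "k < n" "\<rho> (Suc j) = Suc k"
    using permutes_Suc_image[OF assms(2,4)] .
  then have "mmul n (pmat \<sigma>) (pmat \<rho>) i j = (pmat \<sigma> i k :: 'a)"
    by (rule pmat_mmul_right[OF assms(2,4)])
  with \<open>\<rho> (Suc j) = Suc k\<close> show ?thesis
    by (simp add: pmat_def)
qed

lemma pmat_id: "pmat id i j = of_bool (i = j)"
  by (simp add: pmat_def)

text \<open>The rank one form of a transposition. Its weighted sum over all edges is the total
  weight times the identity minus the Laplacian.\<close>

lemma pmat_edge_transp:
  assumes "e \<in> complete_edges n"
  shows "pmat (edge_transp e) i j = of_bool (i = j) - edge_vec e (Suc i) * edge_vec e (Suc j)"
  using edge_ends(4)[OF assms] by (auto simp: pmat_def edge_transp_def edge_vec_def transpose_def)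

lemma sum_edge_vec:
  assumes "e \<in> complete_edges n"
  shows "(\<Sum>i<n. edge_vec e (Suc i)) = (0 :: 'a::comm_ring_1)"
proof -
  have "(\<Sum>i<n. edge_vec e (Suc i)) = (\<Sum>i=1..n. edge_vec e i :: 'a)"
    by (rule sum.reindex_bij_witness[of _ "\<lambda>i. i - 1" Suc]) auto
  also have "\<dots> = 0"
    using edge_ends(2,3)[OF assms] by (simp add: edge_vec_def sum_subtractf of_bool_def)
  finally show ?thesis .
qed

lemma sum_edge_vec_square:
  assumes "e \<in> complete_edges n"
  shows "(\<Sum>i<n. edge_vec e (Suc i) * edge_vec e (Suc i)) = (2 :: 'a::comm_ring_1)"
proof -
  have "(\<Sum>i<n. edge_vec e (Suc i) * edge_vec e (Suc i)) =
      (\<Sum>i=1..n. edge_vec e i * edge_vec e i :: 'a)"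
    by (rule sum.reindex_bij_witness[of _ "\<lambda>i. i - 1" Suc]) auto
  also have "\<dots> = (\<Sum>i=1..n. of_bool (i = Min e) + of_bool (i = Max e))"
    using edge_ends(4)[OF assms] by (intro sum.cong) (auto simp: edge_vec_def)
  also have "\<dots> = 2"
    using edge_ends(2,3)[OF assms] by (simp add: sum.distrib of_bool_def)
  finally show ?thesis .
qed

text \<open>The kernel of 1 - P contains the constant vectors. Adding J removes these and keeps the
  invariant vectors of sum 0, so singularity detects a second orbit.\<close>

definition cycle_mat :: "(nat \<Rightarrow> nat) \<Rightarrow> nat \<Rightarrow> nat \<Rightarrow> 'a::comm_ring_1" where
  "cycle_mat \<sigma> i j = 1 + of_bool (i = j) - pmat \<sigma> i j"

lemma fdet_eq_0_iff:
  fixes f :: "nat \<Rightarrow> nat \<Rightarrow> 'a::field"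
  shows "fdet n f = 0 \<longleftrightarrow> (\<exists>v. (\<exists>i<n. v i \<noteq> 0) \<and> (\<forall>i<n. (\<Sum>j<n. f i j * v j) = 0))"
    (is "_ \<longleftrightarrow> (\<exists>v. ?P v)")
proof -
  let ?M = "mat n n (\<lambda>(i, j). f i j)"
  have kernel: "?P v \<longleftrightarrow> vec n v \<noteq> 0\<^sub>v n \<and> ?M *\<^sub>v vec n v = 0\<^sub>v n" for v
    by (auto simp: vec_eq_iff scalar_prod_def lessThan_atLeast0)
  have "fdet n f = 0 \<longleftrightarrow> (\<exists>v. v \<in> carrier_vec n \<and> v \<noteq> 0\<^sub>v n \<and> ?M *\<^sub>v v = 0\<^sub>v n)"
    unfolding fdet_def by (rule det_0_iff_vec_prod_zero_field) simp
  also have "\<dots> \<longleftrightarrow> (\<exists>v. ?P v)"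
  proof
    assume "\<exists>v. v \<in> carrier_vec n \<and> v \<noteq> 0\<^sub>v n \<and> ?M *\<^sub>v v = 0\<^sub>v n"
    then obtain v where v: "v \<in> carrier_vec n" "v \<noteq> 0\<^sub>v n" "?M *\<^sub>v v = 0\<^sub>v n" by blast
    have "vec n (\<lambda>i. v $ i) = v"
      using v(1) by auto
    with v have "?P (\<lambda>i. v $ i)"
      unfolding kernel by simp
    then show "\<exists>v. ?P v" by blast
  next
    assume "\<exists>v. ?P v"
    then obtain v where "?P v" by blast
    then show "\<exists>v. v \<in> carrier_vec n \<and> v \<noteq> 0\<^sub>v n \<and> ?M *\<^sub>v v = 0\<^sub>v n"
      unfolding kernel by (intro exI[of _ "vec n v"]) simp
  qed
  finally show ?thesis .
qed

lemma cycle_mat_mult_vec: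
  fixes f :: "nat \<Rightarrow> 'a::comm_ring_1"
  assumes "\<sigma> permutes {1..n}" "i < n" "k < n" "Suc i = \<sigma> (Suc k)"
  shows "(\<Sum>j<n. cycle_mat \<sigma> i j * f (Suc j)) = (\<Sum>j<n. f (Suc j)) + f (\<sigma> (Suc k)) - f (Suc k)"
proof -
  have "(\<Sum>j<n. pmat \<sigma> i j * f (Suc j)) = f (Suc k)"
    using pmat_mmul_left[OF assms, of "\<lambda>j _. f (Suc j)" 0] by (simp add: mmul_def)
  moreover have "(\<Sum>j<n. of_bool (i = j) * f (Suc j)) = f (Suc i)"
    using assms(2) by (simp add: of_bool_def if_distrib[of "\<lambda>x. x * _"] cong: if_cong)
  ultimately show ?thesis
    using assms(4) by (simp add: cycle_mat_def algebra_simps sum.distrib sum_subtractf)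
qed

lemma fdet_cycle_mat_nonzero:
  assumes n: "n \<ge> 1" and \<sigma>: "\<sigma> permutes {1..n}" and cyc: "is_full_cycle n \<sigma>"
  shows "fdet n (cycle_mat \<sigma> :: nat \<Rightarrow> nat \<Rightarrow> complex) \<noteq> 0"
proof
  assume "fdet n (cycle_mat \<sigma> :: nat \<Rightarrow> nat \<Rightarrow> complex) = 0"
  then obtain v :: "nat \<Rightarrow> complex" where v: "\<exists>i<n. v i \<noteq> 0" "\<And>i. i < n \<Longrightarrow> (\<Sum>j<n. cycle_mat \<sigma> i j * v j) = 0"
    unfolding fdet_eq_0_iff by blast
  define f where "f x = v (x - 1)" for x
  define S where "S = (\<Sum>j<n. f (Suc j))"
  have step: "S + f (\<sigma> x) - f x = 0" if x: "x \<in> {1..n}" for x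
  proof -
    obtain k where k: "x = Suc k" "k < n"
      using x by (cases x) auto
    obtain i where i: "i < n" "\<sigma> (Suc k) = Suc i"
      using permutes_Suc_image[OF \<sigma> k(2)] .
    then show ?thesis
      using cycle_mat_mult_vec[OF \<sigma> i(1) k(2), of f] v(2)[OF i(1)] k by (simp add: f_def S_def)
  qed
  \<comment> \<open>Summed over all vertices, the two sums of \<open>f\<close> cancel because
    \<open>\<sigma>\<close> permutes the vertices. This leaves \<open>n * S = 0\<close>.\<close>
  have "0 = (\<Sum>x\<in>{1..n}. S + f (\<sigma> x) - f x)"
    using step by (intro sum.neutral[symmetric]) blast
  also have "\<dots> = of_nat n * S + (\<Sum>x\<in>{1..n}. f (\<sigma> x)) - (\<Sum>x\<in>{1..n}. f x)"
    by (simp add: sum.distrib sum_subtractf)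
  also have "(\<Sum>x\<in>{1..n}. f (\<sigma> x)) = (\<Sum>x\<in>{1..n}. f x)"
    using sum.permute[OF \<sigma>, of f] by (simp add: o_def)
  finally have S: "S = 0"
    using n by simp
  have const: "f x = f 1" if "x \<in> {1..n}" for x
    using full_cycle_invariant_const[OF cyc, of f x 1] step S that n by auto
  have "S = (\<Sum>j<n. f 1)"
    unfolding S_def by (intro sum.cong refl const) auto
  then have "f 1 = 0"
    using S n by simp
  then have "v i = 0" if "i < n" for i
    using const[of "Suc i"] that by (simp add: f_def del: One_nat_def)
  with v(1) show False by blast
qed

lemma fdet_cycle_mat_zero:
  assumes n: "n \<ge> 1" and \<sigma>: "\<sigma> permutes {1..n}" and "\<not> is_full_cycle n \<sigma>"
  shows "fdet n (cycle_mat \<sigma> :: nat \<Rightarrow> nat \<Rightarrow> complex) = 0"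
proof -
  have "\<exists>f :: nat \<Rightarrow> complex. (\<forall>x\<in>{1..n}. f (\<sigma> x) = f x) \<and> \<not> (\<forall>x\<in>{1..n}. f x = f 1)"
    using full_cycleI[OF \<sigma> n, where 'a = complex] assms(3) by blast
  then obtain f :: "nat \<Rightarrow> complex" and y
    where f: "\<And>x. x \<in> {1..n} \<Longrightarrow> f (\<sigma> x) = f x" "y \<in> {1..n}" "f y \<noteq> f 1" by blast
  \<comment> \<open>Centring at the mean makes the entries sum to 0, which removes the contribution
    of J and keeps the invariance.\<close>
  define m where "m = (\<Sum>j<n. f (Suc j)) / of_nat n"
  define h where "h x = f x - m" for x
  have sum_h: "(\<Sum>j<n. h (Suc j)) = 0"
    using n by (simp add: h_def m_def sum_subtractf)
  have "h y \<noteq> 0 \<or> h 1 \<noteq> 0"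
    using f(3) by (auto simp: h_def)
  then have "\<exists>x\<in>{1..n}. h x \<noteq> 0"
    using f(2) n by auto
  then obtain x where "x \<in> {1..n}" "h x \<noteq> 0" by blast
  then have nonzero: "\<exists>i<n. h (Suc i) \<noteq> 0"
    by (intro exI[of _ "x - 1"]) auto
  have "(\<Sum>j<n. cycle_mat \<sigma> i j * h (Suc j)) = 0" if i: "i < n" for i
  proof -
    obtain k where k: "k < n" "Suc i = \<sigma> (Suc k)"
      using permutes_Suc_preimage[OF \<sigma> i] .
    then show ?thesis
      using cycle_mat_mult_vec[OF \<sigma> i k, of h] sum_h f(1)[of "Suc k"] by (simp add: h_def)
  qed
  with nonzero show ?thesis
    unfolding fdet_eq_0_iff by (intro exI[of _ "\<lambda>i. h (Suc i)"]) simp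
qed

lemma full_cycles_conjugate:
  assumes "is_full_cycle n \<sigma>" "is_full_cycle n \<rho>"
  obtains q where "q permutes {1..n}" "\<rho> \<circ> q = q \<circ> \<sigma>"
proof -
  obtain cs ds where cs: "cycle cs" "set cs = {1..n}" "\<sigma> = cycle_of_list cs"
    and ds: "cycle ds" "set ds = {1..n}" "\<rho> = cycle_of_list ds"
    using assms unfolding is_full_cycle_def by blast
  have len: "length cs = n" "length ds = n"
    using distinct_card[OF cs(1)] distinct_card[OF ds(1)] cs(2) ds(2) by auto
  have bc: "bij_betw ((!) cs) {..<n} {1..n}" and bd: "bij_betw ((!) ds) {..<n} {1..n}"
    using bij_betw_nth[OF cs(1), of "{..<n}" "{1..n}"] bij_betw_nth[OF ds(1), of "{..<n}" "{1..n}"]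
      len cs(2) ds(2) by auto
  define q where "q x = (if x \<in> {1..n} then ds ! (inv_into {..<n} ((!) cs) x) else x)" for x
  have "bij_betw (((!) ds) \<circ> inv_into {..<n} ((!) cs)) {1..n} {1..n}"
    using bij_betw_trans[OF bij_betw_inv_into[OF bc] bd] .
  then have "bij_betw q {1..n} {1..n}"
    by (rule bij_betw_cong[THEN iffD1, rotated]) (simp add: q_def)
  then have q: "q permutes {1..n}"
    by (rule bij_imp_permutes) (auto simp: q_def)
  have "q (cs ! i) = ds ! i" if "i < n" for i
    using bij_betw_inv_into_left[OF bc, of i] bij_betwE[OF bc] that by (simp add: q_def)
  then have "map q cs = ds"
    using len by (intro nth_equalityI) auto
  then have "q \<circ> \<sigma> \<circ> Hilbert_Choice.inv q = \<rho>"
    using conjugation_of_cycle[OF cs(1) permutes_bij[OF q]] cs(3) ds(3) by simp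
  then have "\<rho> \<circ> q = q \<circ> \<sigma> \<circ> (Hilbert_Choice.inv q \<circ> q)"
    by (auto simp: comp_assoc)
  then show ?thesis
    using that q permutes_inv_o(2)[OF q] by simp
qed

text \<open>Conjugation by a permutation matrix fixes J. The determinant of that matrix is a unit
  because the inverse permutation has one too, so any commutative ring will do.\<close>

lemma fdet_cycle_mat_conjugate:
  assumes q: "q permutes {1..n}" and \<sigma>: "\<sigma> permutes {1..n}" and \<rho>: "\<rho> permutes {1..n}"
    and conj: "\<rho> \<circ> q = q \<circ> \<sigma>"
  shows "fdet n (cycle_mat \<rho>) = fdet n (cycle_mat \<sigma> :: nat \<Rightarrow> nat \<Rightarrow> 'a::comm_ring_1)"
proof -
  let ?P = "pmat q :: nat \<Rightarrow> nat \<Rightarrow> 'a"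
  have inv: "fdet n ?P * fdet n (pmat (Hilbert_Choice.inv q)) = 1"
  proof -
    have "fdet n (mmul n ?P (pmat (Hilbert_Choice.inv q))) = fdet n (\<lambda>i j. if i = j then 1 else 0)"
      by (rule fdet_cong)
        (simp add: mmul_pmat[OF q permutes_inv[OF q]] permutes_inv_o[OF q] pmat_id)
    then show ?thesis
      by (simp add: fdet_mmul fdet_one)
  qed
  have "mmul n ?P (cycle_mat \<sigma>) i j = mmul n (cycle_mat \<rho>) ?P i j" if ij: "i < n" "j < n" for i j
  proof -
    obtain k where k: "k < n" "Suc i = q (Suc k)"
      using permutes_Suc_preimage[OF q ij(1)] .
    obtain l where l: "l < n" "q (Suc j) = Suc l"
      using permutes_Suc_image[OF q ij(2)] .
    have inj: "q x = q y \<longleftrightarrow> x = y" for x y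
      using permutes_inj[OF q] by (auto dest: injD)
    have "Suc i = Suc l \<longleftrightarrow> Suc k = Suc j"
      using k(2) l(2) inj by metis
    moreover have "\<rho> (Suc l) = q (\<sigma> (Suc j))"
      using fun_cong[OF conj, of "Suc j"] l(2) by simp
    then have "Suc i = \<rho> (Suc l) \<longleftrightarrow> Suc k = \<sigma> (Suc j)"
      using k(2) inj by metis
    ultimately have "cycle_mat \<sigma> k j = (cycle_mat \<rho> i l :: 'a)"
      by (auto simp: cycle_mat_def pmat_def)
    then show ?thesis
      unfolding pmat_mmul_left[OF q ij(1) k] pmat_mmul_right[OF q ij(2) l] .
  qed
  then have eq: "fdet n ?P * fdet n (cycle_mat \<sigma>) = fdet n (cycle_mat \<rho>) * fdet n ?P"
    using fdet_cong[of n "mmul n ?P (cycle_mat \<sigma>)" "mmul n (cycle_mat \<rho>) ?P"] by (simp add: fdet_mmul)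
  have "fdet n (cycle_mat \<rho>) = fdet n (pmat (Hilbert_Choice.inv q)) * (fdet n (cycle_mat \<rho>) * fdet n ?P)"
    using inv by (metis mult.assoc mult.commute mult.right_neutral)
  also have "\<dots> = fdet n (cycle_mat \<sigma>)"
    unfolding eq[symmetric] using inv by (metis mult.assoc mult.commute mult.left_neutral)
  finally show ?thesis .
qed

text \<open>Kernel arguments decide only whether the determinant vanishes; conjugacy of full cycles
  makes the nonzero value uniform. It stays unevaluated and is cancelled later.\<close>

lemma fdet_cycle_mat_indicator:
  assumes n: "n \<ge> 1"
  obtains c :: complex where "c \<noteq> 0"
    "\<And>\<sigma>. \<sigma> permutes {1..n} \<Longrightarrow> fdet n (cycle_mat \<sigma>) = (if is_full_cycle n \<sigma> then c else 0)"
proof -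
  let ?\<rho> = "cycle_of_list [1..<Suc n]"
  have set: "set [1..<Suc n] = {1..n}" by auto
  have \<rho>: "is_full_cycle n ?\<rho>"
    unfolding is_full_cycle_def using set by (intro exI[of _ "[1..<Suc n]"]) simp
  have perm: "?\<rho> permutes {1..n}"
    using cycle_permutes[of "[1..<Suc n]"] unfolding set .
  have "fdet n (cycle_mat \<sigma>) = (fdet n (cycle_mat ?\<rho>) :: complex)"
    if "\<sigma> permutes {1..n}" "is_full_cycle n \<sigma>" for \<sigma>
    using full_cycles_conjugate[OF \<rho> that(2)] fdet_cycle_mat_conjugate[OF _ perm that(1)] by metis
  then show ?thesis
    using that[of "fdet n (cycle_mat ?\<rho>)"] fdet_cycle_mat_nonzero[OF n perm \<rho>] fdet_cycle_mat_zero[OF n]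
    by metis
qed

section \<open>Power series of a matrix\<close>

lemma mmul_assoc: "mmul n (mmul n f g) h i j = mmul n f (mmul n g h) i j"
  unfolding mmul_def sum_distrib_left sum_distrib_right
  by (subst sum.swap) (simp add: mult_ac)

lemma mmul_cong:
  "(\<And>k. k < n \<Longrightarrow> f i k = f' i k) \<Longrightarrow> (\<And>k. k < n \<Longrightarrow> g k j = g' k j) \<Longrightarrow>
    mmul n f g i j = mmul n f' g' i j"
  unfolding mmul_def by (intro sum.cong) auto

primrec mpow :: "nat \<Rightarrow> (nat \<Rightarrow> nat \<Rightarrow> 'a::comm_ring_1) \<Rightarrow> nat \<Rightarrow> nat \<Rightarrow> nat \<Rightarrow> 'a" where
  "mpow n A 0 = (\<lambda>i j. of_bool (i = j))"
| "mpow n A (Suc k) = mmul n (mpow n A k) A"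

lemma sum_of_bool_mult:
  fixes f :: "nat \<Rightarrow> 'a::comm_ring_1"
  assumes "i < n"
  shows "(\<Sum>k<n. of_bool (i = k) * f k) = f i" "(\<Sum>k<n. f k * of_bool (k = i)) = f i"
  using assms by (simp_all add: of_bool_def if_distrib[of "\<lambda>x. x * _"] if_distrib[of "\<lambda>x. _ * x"] cong: if_cong)

lemma mpow_add:
  assumes "i < n" "j < n"
  shows "mmul n (mpow n A a) (mpow n A b) i j = mpow n A (a + b) i j"
  using assms(2)
proof (induction b arbitrary: j)
  case 0
  then show ?case
    using sum_of_bool_mult(2)[OF 0, of "mpow n A a i"] by (simp add: mmul_def)
next
  case (Suc b)
  have "mmul n (mpow n A a) (mpow n A (Suc b)) i j = mmul n (mmul n (mpow n A a) (mpow n A b)) A i j"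
    by (simp add: mmul_assoc)
  also have "\<dots> = mmul n (mpow n A (a + b)) A i j"
    by (intro mmul_cong Suc.IH refl)
  finally show ?case by simp
qed

lemma mpow_Suc_left:
  assumes "i < n" "j < n"
  shows "mpow n A (Suc k) i j = (\<Sum>l<n. A i l * mpow n A k l j)"
proof -
  have "mpow n A (Suc k) i j = mmul n (mpow n A 1) (mpow n A k) i j"
    using mpow_add[OF assms, of A 1 k] by simp
  also have "\<dots> = mmul n A (mpow n A k) i j"
    by (rule mmul_cong) (use assms in \<open>auto simp: mmul_def sum_of_bool_mult\<close>)
  finally show ?thesis
    by (simp add: mmul_def)
qed

text \<open>This is f(tA), with t the variable of the series and \<open>\<kappa>\<close> embedding
  the coefficients.\<close>

definition fmat :: "nat \<Rightarrow> (complex \<Rightarrow> 'a) \<Rightarrow> (nat \<Rightarrow> nat \<Rightarrow> 'a::comm_ring_1) \<Rightarrow> complex fps \<Rightarrow> nat \<Rightarrow> nat \<Rightarrow> 'a fps" where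
  "fmat n \<kappa> A f i j = Abs_fps (\<lambda>k. \<kappa> (fps_nth f k) * mpow n A k i j)"

definition fps_scale :: "(complex \<Rightarrow> 'a) \<Rightarrow> 'a::comm_ring_1 \<Rightarrow> complex fps \<Rightarrow> 'a fps" where
  "fps_scale \<kappa> x f = Abs_fps (\<lambda>k. \<kappa> (fps_nth f k) * x ^ k)"

lemma fps_const_hom: "comm_ring_hom (fps_const :: 'a::comm_ring_1 \<Rightarrow> 'a fps)"
  by unfold_locales auto

lemma fps_nth_0_hom: "comm_ring_hom (\<lambda>f :: 'a::comm_ring_1 fps. fps_nth f 0)"
  by unfold_locales auto

lemma fps_const_sum: "fps_const (sum f S) = (\<Sum>x\<in>S. fps_const (f x :: 'a::comm_ring_1))"
  by (induction S rule: infinite_finite_induct) (auto simp flip: fps_const_add)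

locale scalar_hom = comm_ring_hom \<kappa> for \<kappa> :: "complex \<Rightarrow> 'a::comm_ring_1"
begin

text \<open>Positive integers are invertible in the image of the complex numbers. Hence a zero
  derivative forces constancy, and factorials cancel.\<close>

lemma of_nat_mult_cancel:
  assumes "of_nat (Suc k) * x = of_nat (Suc k) * (y :: 'a)"
  shows "x = y"
proof -
  have inv: "\<kappa> (inverse (of_nat (Suc k))) * of_nat (Suc k) = 1"
  proof -
    have "\<kappa> (inverse (of_nat (Suc k))) * of_nat (Suc k) =
        \<kappa> (inverse (of_nat (Suc k)) * of_nat (Suc k))"
      by (simp only: hom_mult hom_of_nat)
    also have "\<dots> = 1"
      by (subst left_inverse) (simp_all del: of_nat_Suc)
    finally show ?thesis .
  qed
  have "x = \<kappa> (inverse (of_nat (Suc k))) * (of_nat (Suc k) * x)"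
    using inv by (simp only: mult.assoc[symmetric] mult_1_left)
  also have "\<dots> = y"
    unfolding assms using inv by (simp only: mult.assoc[symmetric] mult_1_left)
  finally show ?thesis .
qed

lemma fmat_mmul:
  assumes "i < n" "j < n"
  shows "mmul n (fmat n \<kappa> A f) (fmat n \<kappa> A g) i j = fmat n \<kappa> A (f * g) i j"
proof (rule fps_ext)
  fix k
  let ?M = "mpow n A"
  have "fps_nth (mmul n (fmat n \<kappa> A f) (fmat n \<kappa> A g) i j) k =
      (\<Sum>l<n. \<Sum>a=0..k. \<kappa> (fps_nth f a) * ?M a i l * (\<kappa> (fps_nth g (k - a)) * ?M (k - a) l j))"
    by (simp add: mmul_def fmat_def fps_sum_nth fps_mult_nth)
  also have "\<dots> = (\<Sum>a=0..k. \<kappa> (fps_nth f a * fps_nth g (k - a)) * mmul n (?M a) (?M (k - a)) i j)"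
    by (subst sum.swap) (simp add: mmul_def sum_distrib_left hom_mult mult_ac)
  also have "\<dots> = (\<Sum>a=0..k. \<kappa> (fps_nth f a * fps_nth g (k - a))) * ?M k i j"
    by (simp add: mpow_add[OF assms] sum_distrib_right)
  also have "\<dots> = fps_nth (fmat n \<kappa> A (f * g) i j) k"
    by (simp add: fmat_def fps_mult_nth hom_sum)
  finally show "fps_nth (mmul n (fmat n \<kappa> A f) (fmat n \<kappa> A g) i j) k = fps_nth (fmat n \<kappa> A (f * g) i j) k" .
qed

lemma fmat_diff: "fmat n \<kappa> A (f - g) i j = fmat n \<kappa> A f i j - fmat n \<kappa> A g i j"
  by (rule fps_ext) (simp add: fmat_def hom_minus algebra_simps)

lemma fmat_const_mult: "fmat n \<kappa> A (fps_const c * f) i j = fps_const (\<kappa> c) * fmat n \<kappa> A f i j"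
  by (rule fps_ext) (simp add: fmat_def hom_mult algebra_simps)

lemma fmat_1: "fmat n \<kappa> A 1 i j = of_bool (i = j)"
  by (rule fps_ext) (simp add: fmat_def fps_one_nth)

lemma fmat_X: "i < n \<Longrightarrow> j < n \<Longrightarrow> fmat n \<kappa> A fps_X i j = fps_X * fps_const (A i j)"
  by (rule fps_ext) (auto simp: fmat_def fps_X_def mmul_def sum_of_bool_mult)

lemma fmat_nth_0: "fps_nth (fmat n \<kappa> A f i j) 0 = \<kappa> (fps_nth f 0) * of_bool (i = j)"
  by (simp add: fmat_def)

lemma fps_deriv_fmat:
  "fps_deriv (fmat n \<kappa> A f i j) = (\<Sum>l<n. fmat n \<kappa> A (fps_deriv f) i l * fps_const (A l j))"
proof (rule fps_ext)
  fix k
  have "fps_nth (fps_deriv (fmat n \<kappa> A f i j)) k =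
      \<kappa> (of_nat (Suc k) * fps_nth f (Suc k)) * mpow n A (Suc k) i j"
    by (simp only: fps_deriv_nth fmat_def fps_nth_Abs_fps hom_mult hom_of_nat Suc_eq_plus1 mult.assoc)
  also have "\<dots> = fps_nth (\<Sum>l<n. fmat n \<kappa> A (fps_deriv f) i l * fps_const (A l j)) k"
    by (simp add: fps_sum_nth fmat_def mmul_def sum_distrib_left mult.assoc)
  finally show "fps_nth (fps_deriv (fmat n \<kappa> A f i j)) k =
    fps_nth (\<Sum>l<n. fmat n \<kappa> A (fps_deriv f) i l * fps_const (A l j)) k" .
qed

text \<open>The derivative of f(tA) with A on the left. The form with A on the right meets the
  matrix \<open>N\<close> in \<open>diff_mat\<close>; this one exhibits a differentiated row as a
  combination of rows.\<close>

lemma fps_deriv_fmat_left: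
  assumes "i < n" "j < n"
  shows "fps_deriv (fmat n \<kappa> A f i j) = (\<Sum>l<n. fps_const (A i l) * fmat n \<kappa> A (fps_deriv f) l j)"
proof (rule fps_ext)
  fix k
  have "fps_nth (fps_deriv (fmat n \<kappa> A f i j)) k =
      \<kappa> (of_nat (Suc k) * fps_nth f (Suc k)) * mpow n A (Suc k) i j"
    by (simp only: fps_deriv_nth fmat_def fps_nth_Abs_fps hom_mult hom_of_nat Suc_eq_plus1 mult.assoc)
  also have "\<dots> = fps_nth (\<Sum>l<n. fps_const (A i l) * fmat n \<kappa> A (fps_deriv f) l j) k"
    unfolding mpow_Suc_left[OF assms]
    by (simp add: fps_sum_nth fmat_def sum_distrib_left mult_ac)
  finally show "fps_nth (fps_deriv (fmat n \<kappa> A f i j)) k =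
    fps_nth (\<Sum>l<n. fps_const (A i l) * fmat n \<kappa> A (fps_deriv f) l j) k" .
qed

lemma fps_deriv_fps_scale_exp: "fps_deriv (fps_scale \<kappa> x (fps_exp 1)) = fps_const x * fps_scale \<kappa> x (fps_exp 1)"
proof (rule fps_ext)
  fix k
  have "fps_nth (fps_deriv (fps_scale \<kappa> x (fps_exp 1))) k =
      \<kappa> (of_nat (Suc k) * fps_nth (fps_exp 1) (Suc k)) * x ^ Suc k"
    by (simp only: fps_deriv_nth fps_scale_def fps_nth_Abs_fps hom_mult hom_of_nat Suc_eq_plus1 mult.assoc)
  also have "of_nat (Suc k) * fps_nth (fps_exp 1) (Suc k) = (fps_nth (fps_exp 1) k :: complex)"
    using fact_Suc[of k, where 'a = complex] by (simp add: divide_simps del: of_nat_Suc fact_Suc)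
  finally show "fps_nth (fps_deriv (fps_scale \<kappa> x (fps_exp 1))) k =
      fps_nth (fps_const x * fps_scale \<kappa> x (fps_exp 1)) k"
    by (simp add: fps_scale_def mult_ac)
qed

lemma fps_scale_nth_0: "fps_nth (fps_scale \<kappa> x f) 0 = \<kappa> (fps_nth f 0)"
  by (simp add: fps_scale_def)

end

section \<open>The generating function of products of transpositions\<close>

locale weighted_edges = scalar_hom \<kappa> for \<kappa> :: "complex \<Rightarrow> 'a::comm_ring_1" +
  fixes n :: nat and c :: "nat set \<Rightarrow> 'a"
begin

definition total_weight :: 'a where
  "total_weight = (\<Sum>e\<in>complete_edges n. c e)"

text \<open>The Laplacian as a sum of rank one terms, one for each transposition;
  \<open>laplacian_index\<close> identifies it with the given matrix.\<close>

definition weighted_laplacian :: "nat \<Rightarrow> nat \<Rightarrow> 'a" where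
  "weighted_laplacian i j = (\<Sum>e\<in>complete_edges n. c e * (edge_vec e (Suc i) * edge_vec e (Suc j)))"

abbreviation lap_series :: "complex fps \<Rightarrow> nat \<Rightarrow> nat \<Rightarrow> 'a fps" where
  "lap_series \<equiv> fmat n \<kappa> weighted_laplacian"

definition exp_weight :: "'a fps" where
  "exp_weight = fps_scale \<kappa> total_weight (fps_exp 1)"

definition diff_mat :: "(nat \<Rightarrow> nat \<Rightarrow> 'a) \<Rightarrow> (nat \<Rightarrow> nat \<Rightarrow> 'a) \<Rightarrow> nat \<Rightarrow> nat \<Rightarrow> 'a fps" where
  "diff_mat Y N i j = fps_const (Y i j) - (\<Sum>k<n. lap_series (fps_exp (-1)) i k * fps_const (N k j))"

text \<open>This is exp(tW) det(Y - exp(-tA) N). \<open>N\<close> is kept free because the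
  differential equation relates it to its products with transposition matrices; \<open>Y\<close>
  will be 1 + J.\<close>

definition heat :: "(nat \<Rightarrow> nat \<Rightarrow> 'a) \<Rightarrow> (nat \<Rightarrow> nat \<Rightarrow> 'a) \<Rightarrow> 'a fps" where
  "heat Y N = exp_weight * fdet n (diff_mat Y N)"

lemma heat_cong:
  assumes "\<And>i j. i < n \<Longrightarrow> j < n \<Longrightarrow> N i j = N' i j"
  shows "heat Y N = heat Y N'"
  unfolding heat_def diff_mat_def
  by (intro arg_cong2[of _ _ _ _ "(*)"] refl fdet_cong arg_cong2[of _ _ _ _ "(-)"] sum.cong)
    (simp_all add: assms)

text \<open>Multiplying by a transposition is a rank one change of the matrix, along which the
  determinant is affine. So the sum of the finite differences over all transpositions is a
  derivative, namely the one along the Laplacian.\<close>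

lemma fps_deriv_heat:
  "fps_deriv (heat Y N) =
    (\<Sum>e\<in>complete_edges n. fps_const (c e) * heat Y (mmul n (pmat (edge_transp e)) N))"
proof -
  let ?E = "lap_series (fps_exp (-1))" and ?K = "complete_edges n"
  let ?M = "diff_mat Y N" and ?C = "fps_const :: 'a \<Rightarrow> 'a fps"
  \<comment> \<open>With E = exp(-tA) and v the edge vector, \<open>u\<close> is E v and
    \<open>z\<close> is v^T N: a transposition changes E N by - u z, hence \<open>diff_mat\<close>
    by + u z.\<close>
  define u where "u e i = (\<Sum>l<n. ?E i l * ?C (edge_vec e (Suc l)))" for e i
  define z where "z e j = (\<Sum>k<n. ?C (edge_vec e (Suc k) * N k j))" for e j
  let ?D = "\<lambda>e. \<Sum>i<n. u e i * fdet n (?M(i := z e))"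
  have transposed: "fdet n (diff_mat Y (mmul n (pmat (edge_transp e)) N)) = fdet n ?M + ?D e"
    if e: "e \<in> ?K" for e
  proof -
    have "diff_mat Y (mmul n (pmat (edge_transp e)) N) i j = ?M i j + u e i * z e j"
      if ij: "i < n" "j < n" for i j
    proof -
      let ?v = "\<lambda>k. edge_vec e (Suc k) :: 'a"
      have PN: "mmul n (pmat (edge_transp e)) N l j = N l j - ?v l * (\<Sum>k<n. ?v k * N k j)"
        if "l < n" for l
      proof -
        have "mmul n (pmat (edge_transp e)) N l j =
            (\<Sum>k<n. of_bool (l = k) * N k j) - (\<Sum>k<n. ?v l * (?v k * N k j))"
          by (simp add: mmul_def pmat_edge_transp[OF e] algebra_simps sum_subtractf)
        then show ?thesis
          by (simp add: sum_of_bool_mult[OF that] sum_distrib_left)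
      qed
      have z: "z e j = ?C (\<Sum>k<n. ?v k * N k j)"
        by (simp only: z_def fps_const_sum)
      have "(\<Sum>l<n. ?E i l * ?C (mmul n (pmat (edge_transp e)) N l j)) =
          (\<Sum>l<n. ?E i l * ?C (N l j) - ?E i l * ?C (?v l) * z e j)"
        by (intro sum.cong refl)
          (simp add: PN z mult.assoc right_diff_distrib flip: fps_const_sub fps_const_mult)
      then show ?thesis
        by (simp add: diff_mat_def u_def sum_subtractf sum_distrib_right)
    qed
    then have "fdet n (diff_mat Y (mmul n (pmat (edge_transp e)) N)) = fdet n (\<lambda>i j. ?M i j + u e i * z e j)"
      by (rule fdet_cong)
    then show ?thesis
      by (simp only: fdet_rank_one)
  qed
  \<comment> \<open>The signs from exp(-tA) and from the difference cancel, so the derivative is E A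
    N, a sum of the same rank one terms weighted by \<open>c e\<close>.\<close>
  have deriv_M: "fps_deriv (?M i j) = (\<Sum>e\<in>?K. (?C (c e) * u e i) * z e j)" for i j
  proof -
    have "fps_deriv (?E i k) = - (\<Sum>l<n. ?E i l * ?C (weighted_laplacian l k))" for k
    proof -
      have "fps_deriv (fps_exp (-1)) = (fps_const (-1) * fps_exp (-1) :: complex fps)"
        by simp
      then show ?thesis
        unfolding fps_deriv_fmat by (simp only: fmat_const_mult hom_uminus hom_one)
          (simp add: sum_negf flip: fps_const_neg)
    qed
    then have "fps_deriv (?M i j) = (\<Sum>k<n. (\<Sum>l<n. ?E i l * ?C (weighted_laplacian l k)) * ?C (N k j))"
      by (simp add: diff_mat_def fps_deriv_sum sum_negf)
    also have "\<dots> = (\<Sum>k<n. \<Sum>l<n. \<Sum>e\<in>?K.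
        ?C (c e) * (?E i l * ?C (edge_vec e (Suc l))) * ?C (edge_vec e (Suc k) * N k j))"
      by (simp add: weighted_laplacian_def fps_const_sum sum_distrib_left sum_distrib_right mult_ac
          flip: fps_const_mult)
    also have "\<dots> = (\<Sum>e\<in>?K. \<Sum>k<n. \<Sum>l<n.
        ?C (c e) * (?E i l * ?C (edge_vec e (Suc l))) * ?C (edge_vec e (Suc k) * N k j))"
      by (simp only: sum.swap[of _ ?K])
    also have "\<dots> = (\<Sum>e\<in>?K. (?C (c e) * u e i) * z e j)"
      unfolding u_def z_def
      by (intro sum.cong refl, subst sum.swap) (simp add: sum_distrib_left sum_distrib_right mult_ac)
    finally show ?thesis .
  qed
  have deriv_det: "fps_deriv (fdet n ?M) = (\<Sum>e\<in>?K. ?C (c e) * ?D e)"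
  proof -
    have "fps_deriv (fdet n ?M) = (\<Sum>i<n. \<Sum>e\<in>?K. (?C (c e) * u e i) * fdet n (?M(i := z e)))"
      unfolding fps_deriv_fdet deriv_M
      by (intro sum.cong refl fdet_row_sum finite_complete_edges) auto
    then show ?thesis
      by (subst (asm) sum.swap) (simp add: sum_distrib_left mult_ac)
  qed
  have "fps_deriv (heat Y N) = ?C total_weight * exp_weight * fdet n ?M + exp_weight * fps_deriv (fdet n ?M)"
    by (simp add: heat_def exp_weight_def fps_deriv_fps_scale_exp)
  \<comment> \<open>Differentiating \<open>exp_weight\<close> supplies the copies of the unperturbed
    determinant that turn differences into values.\<close>
  also have "\<dots> = (\<Sum>e\<in>?K. ?C (c e) * (exp_weight * (fdet n ?M + ?D e)))"
    unfolding deriv_det total_weight_def fps_const_sum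
    by (simp only: sum_distrib_left sum_distrib_right distrib_left sum.distrib mult_ac)
  also have "\<dots> = (\<Sum>e\<in>?K. ?C (c e) * heat Y (mmul n (pmat (edge_transp e)) N))"
    by (intro sum.cong refl) (simp add: heat_def transposed)
  finally show ?thesis .
qed

lemma heat_nth_0: "fps_nth (heat Y N) 0 = fdet n (\<lambda>i j. Y i j - N i j)"
proof -
  have "fps_nth (fdet n (diff_mat Y N)) 0 = fdet n (\<lambda>i j. fps_nth (diff_mat Y N i j) 0)"
    by (rule comm_ring_hom.hom_fdet[OF fps_nth_0_hom])
  also have "\<dots> = fdet n (\<lambda>i j. Y i j - N i j)"
    by (rule fdet_cong) (simp add: diff_mat_def fps_sum_nth fmat_nth_0 sum_of_bool_mult)
  finally show ?thesis
    by (simp add: heat_def exp_weight_def fps_scale_nth_0)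
qed

definition edge_lists :: "nat \<Rightarrow> nat set list set" where
  "edge_lists m = {es. set es \<subseteq> complete_edges n \<and> length es = m}"

text \<open>Each derivative splits off the first edge of the list: its transposition is absorbed
  into \<open>\<sigma>\<close>, which is why \<open>\<sigma>\<close> is arbitrary. The factorial
  turns Taylor coefficients into iterated derivatives.\<close>

lemma heat_nth:
  assumes "\<sigma> permutes {1..n}"
  shows "of_nat (fact m) * fps_nth (heat Y (pmat \<sigma>)) m =
    (\<Sum>es\<in>edge_lists m. prod_list (map c es) * fdet n (\<lambda>i j. Y i j - pmat (edge_list_prod es \<circ> \<sigma>) i j))"
  using assms
proof (induction m arbitrary: \<sigma>)
  case 0
  have "edge_lists 0 = {[]}"
    by (auto simp: edge_lists_def)
  then show ?case
    by (simp add: heat_nth_0)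
next
  case (Suc m)
  let ?F = "\<lambda>es. prod_list (map c es) * fdet n (\<lambda>i j. Y i j - pmat (edge_list_prod es \<circ> \<sigma>) i j)"
  have perm: "edge_transp e \<circ> \<sigma> permutes {1..n}" if "e \<in> complete_edges n" for e
    using permutes_compose[OF Suc.prems edge_transp_permutes[OF that]] .
  have step: "heat Y (mmul n (pmat (edge_transp e)) (pmat \<sigma>)) = heat Y (pmat (edge_transp e \<circ> \<sigma>))"
    if "e \<in> complete_edges n" for e
    by (rule heat_cong) (rule mmul_pmat[OF edge_transp_permutes[OF that] Suc.prems])
  have lists: "edge_lists (Suc m) = (\<lambda>(e, es). e # es) ` (complete_edges n \<times> edge_lists m)"
    by (auto simp: edge_lists_def length_Suc_conv image_iff)
  have "of_nat (fact (Suc m)) * fps_nth (heat Y (pmat \<sigma>)) (Suc m) =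
      of_nat (fact m) * fps_nth (fps_deriv (heat Y (pmat \<sigma>))) m"
    by (simp add: algebra_simps)
  also have "\<dots> = (\<Sum>e\<in>complete_edges n. c e * (of_nat (fact m) * fps_nth (heat Y (pmat (edge_transp e \<circ> \<sigma>))) m))"
    by (simp add: fps_deriv_heat fps_sum_nth sum_distrib_left step mult_ac)
  also have "\<dots> = (\<Sum>e\<in>complete_edges n. \<Sum>es\<in>edge_lists m. ?F (e # es))"
    by (intro sum.cong refl)
      (simp only: Suc.IH[OF perm] sum_distrib_left edge_list_prod_Cons comp_assoc list.map prod_list.Cons mult.assoc)
  also have "\<dots> = (\<Sum>es\<in>edge_lists (Suc m). ?F es)"
    unfolding lists sum.cartesian_product
    by (subst sum.reindex) (auto simp: inj_on_def intro: sum.cong)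
  finally show ?case .
qed

end

section \<open>Evaluation of the determinant\<close>

lemma phi_exp: "fps_X * phi * fps_exp (-(1/2)) = 1 - fps_exp (-1 :: complex)"
proof -
  have "fps_X * phi = (fps_exp (1/2) - fps_exp (-(1/2)) :: complex fps)"
  proof (rule fps_ext)
    fix m
    show "fps_nth (fps_X * phi) m = fps_nth (fps_exp (1/2) - fps_exp (-(1/2)) :: complex fps) m"
      by (cases m) (auto simp: phi_nth power_minus_odd power_one_over field_simps simp del: fact_Suc)
  qed
  then show ?thesis
    by (simp add: left_diff_distrib flip: fps_exp_add_mult)
qed

context weighted_edges
begin

lemma sum_column_laplacian: "(\<Sum>l<n. weighted_laplacian l j) = 0"
proof -
  have "(\<Sum>l<n. weighted_laplacian l j) =
      (\<Sum>e\<in>complete_edges n. c e * edge_vec e (Suc j) * (\<Sum>l<n. edge_vec e (Suc l)))"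
    unfolding weighted_laplacian_def sum_distrib_left by (subst sum.swap) (simp add: mult_ac)
  also have "\<dots> = 0"
    by (intro sum.neutral ballI) (simp add: sum_edge_vec)
  finally show ?thesis .
qed

lemma sum_column_mpow:
  assumes "j < n"
  shows "(\<Sum>l<n. mpow n weighted_laplacian k l j) = of_bool (k = 0)"
  using assms
proof (induction k arbitrary: j)
  case 0
  then show ?case
    using sum_of_bool_mult(2)[OF 0, of "\<lambda>_. 1 :: 'a"] by simp
next
  case (Suc k)
  have "(\<Sum>l<n. mpow n weighted_laplacian (Suc k) l j) =
      (\<Sum>m<n. (\<Sum>l<n. mpow n weighted_laplacian k l m) * weighted_laplacian m j)"
    unfolding mpow.simps mmul_def sum_distrib_right by (rule sum.swap)
  also have "\<dots> = of_bool (k = 0) * (\<Sum>m<n. weighted_laplacian m j)"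
    unfolding sum_distrib_left by (intro sum.cong refl) (simp add: Suc.IH)
  finally show ?case
    by (simp add: sum_column_laplacian)
qed

text \<open>The identity J f(tA) = f(0) J, read column by column.\<close>

lemma sum_column_lap_series:
  assumes "j < n"
  shows "(\<Sum>l<n. lap_series f l j) = fps_const (\<kappa> (fps_nth f 0))"
proof (rule fps_ext)
  fix k
  have "fps_nth (\<Sum>l<n. lap_series f l j) k = \<kappa> (fps_nth f k) * (\<Sum>l<n. mpow n weighted_laplacian k l j)"
    by (simp add: fps_sum_nth fmat_def sum_distrib_left)
  then show "fps_nth (\<Sum>l<n. lap_series f l j) k = fps_nth (fps_const (\<kappa> (fps_nth f 0))) k"
    by (simp add: sum_column_mpow[OF assms])
qed

lemma trace_laplacian: "(\<Sum>i<n. weighted_laplacian i i) = 2 * total_weight"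
proof -
  have "(\<Sum>i<n. weighted_laplacian i i) =
      (\<Sum>e\<in>complete_edges n. c e * (\<Sum>i<n. edge_vec e (Suc i) * edge_vec e (Suc i)))"
    unfolding weighted_laplacian_def sum_distrib_left by (rule sum.swap)
  also have "\<dots> = (\<Sum>e\<in>complete_edges n. 2 * c e)"
    by (intro sum.cong refl) (simp add: sum_edge_vec_square)
  finally show ?thesis
    by (simp add: total_weight_def sum_distrib_left)
qed

lemma fdet_lap_series_nth_0:
  assumes "fps_nth f 0 = 1"
  shows "fps_nth (fdet n (lap_series f)) 0 = 1"
proof -
  have "fps_nth (fdet n (lap_series f)) 0 = fdet n (\<lambda>i j. fps_nth (lap_series f i j) 0)"
    by (rule comm_ring_hom.hom_fdet[OF fps_nth_0_hom])
  also have "\<dots> = fdet n (\<lambda>i j. if i = j then 1 else 0)"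
    by (rule fdet_cong) (simp add: fmat_nth_0 assms)
  finally show ?thesis
    by (simp add: fdet_one)
qed

text \<open>By Jacobi's formula, det exp(-tA/2) = exp(-tW): the derivative of row \<open>i\<close>
  is a combination of all rows, of which only the diagonal coefficient contributes, and the trace of
  A is 2W. The product thus has zero derivative and constant term 1.\<close>

lemma exp_weight_fdet: "exp_weight * fdet n (lap_series (fps_exp (-(1/2)))) = 1"
proof -
  let ?h = "fps_exp (-(1/2)) :: complex fps" and ?C = "fps_const :: 'a \<Rightarrow> 'a fps"
  let ?H = "lap_series ?h" and ?s = "\<kappa> (-(1/2))"
  have row: "fps_deriv (?H i j) = (\<Sum>k<n. ?C (weighted_laplacian i k * ?s) * ?H k j)"
    if "i < n" "j < n" for i j
    unfolding fps_deriv_fmat_left[OF that]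
    by (simp only: fps_exp_deriv fmat_const_mult) (simp add: mult.assoc flip: fps_const_mult)
  have "fps_deriv (fdet n ?H) = (\<Sum>i<n. ?C (weighted_laplacian i i * ?s) * fdet n ?H)"
    unfolding fps_deriv_fdet
  proof (rule sum.cong[OF refl])
    fix i
    assume i: "i \<in> {..<n}"
    have "fdet n (?H(i := \<lambda>j. fps_deriv (?H i j))) =
        fdet n (?H(i := \<lambda>j. \<Sum>k<n. ?C (weighted_laplacian i k * ?s) * ?H k j))"
      by (rule fdet_cong) (use i row in auto)
    also have "\<dots> = ?C (weighted_laplacian i i * ?s) * fdet n ?H"
      by (rule fdet_row_combination) (use i in simp)
    finally show "fdet n (?H(i := \<lambda>j. fps_deriv (?H i j))) = ?C (weighted_laplacian i i * ?s) * fdet n ?H" .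
  qed
  also have "\<dots> = ?C ((\<Sum>i<n. weighted_laplacian i i) * ?s) * fdet n ?H"
    by (simp only: fps_const_sum sum_distrib_right)
  also have "(\<Sum>i<n. weighted_laplacian i i) * ?s = - total_weight"
  proof -
    have "2 * ?s = \<kappa> (2 * (-(1/2)))"
      by (simp only: hom_mult hom_numeral)
    also have "\<dots> = -1"
      by (simp add: hom_uminus)
    finally show ?thesis
      unfolding trace_laplacian by (metis mult.assoc mult.commute mult_minus1)
  qed
  finally have deriv: "fps_deriv (fdet n ?H) = - (?C total_weight * fdet n ?H)"
    by (simp flip: fps_const_neg)
  let ?F = "exp_weight * fdet n ?H"
  have "fps_deriv ?F = 0"
    by (simp add: exp_weight_def fps_deriv_fps_scale_exp deriv mult_ac)
  have "fps_nth ?F (Suc k) = 0" for k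
  proof (rule of_nat_mult_cancel)
    have "of_nat (Suc k) * fps_nth ?F (Suc k) = fps_nth (fps_deriv ?F) k"
      by (simp only: fps_deriv_nth Suc_eq_plus1)
    then show "of_nat (Suc k) * fps_nth ?F (Suc k) = of_nat (Suc k) * 0"
      by (simp only: \<open>fps_deriv ?F = 0\<close> fps_zero_nth mult_zero_right)
  qed
  moreover have "fps_nth ?F 0 = 1"
    by (simp add: fdet_lap_series_nth_0 exp_weight_def fps_scale_nth_0)
  ultimately have "fps_nth ?F k = fps_nth 1 k" for k
    by (cases k) simp_all
  then show ?thesis
    by (rule fps_ext)
qed

text \<open>The sum of all cofactors of the Laplacian, since a row of ones adds up the cofactors of
  that row.\<close>

definition cofactor_sum :: 'a where
  "cofactor_sum = (\<Sum>i<n. fdet n (weighted_laplacian(i := \<lambda>_. 1)))"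

lemma fdet_laplacian:
  assumes "n \<ge> 1"
  shows "fdet n weighted_laplacian = 0"
proof -
  have "fdet n weighted_laplacian =
      fdet n (weighted_laplacian(0 := \<lambda>j. \<Sum>k<n. 1 * weighted_laplacian k j))"
    using assms by (subst fdet_row_combination) auto
  \<comment> \<open>The zero row is written as an empty combination, so that row linearity gives
    0.\<close>
  also have "\<dots> = fdet n (weighted_laplacian(0 := \<lambda>j. \<Sum>t\<in>{}. 0 * weighted_laplacian t j))"
    by (simp add: sum_column_laplacian)
  also have "\<dots> = 0"
    using assms by (subst fdet_row_sum) auto
  finally show ?thesis .
qed

text \<open>J has rank one, so the determinant splits into det(tA) = 0 and terms with one row of
  ones, each with its other \<open>n - 1\<close> rows scaled by t.\<close>

lemma fdet_add_ones:
  assumes n: "n \<ge> 1"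
  shows "fdet n (\<lambda>i j. 1 + lap_series fps_X i j) = fps_X ^ (n - 1) * fps_const cofactor_sum"
proof -
  let ?C = "fps_const :: 'a \<Rightarrow> 'a fps"
  let ?L = "\<lambda>i j. ?C (weighted_laplacian i j)"
  let ?XL = "\<lambda>i j. fps_X * ?L i j"
  have scaled: "fdet n ?XL = fps_X ^ n * fdet n ?L"
    unfolding fdet_Leibniz by (simp add: prod.distrib sum_distrib_left mult_ac)
  have row: "fdet n (?XL(i := \<lambda>_. 1)) = fps_X ^ (n - 1) * fdet n (?L(i := \<lambda>_. 1))" if "i < n" for i
    unfolding fdet_upd_Leibniz[OF that]
    using that by (simp add: prod.distrib sum_distrib_left mult_ac)
  have const: "fdet n (\<lambda>i j. ?C (f i j)) = ?C (fdet n f)" for f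
    by (rule comm_ring_hom.hom_fdet[OF fps_const_hom, symmetric])
  have const_row: "fdet n (?L(i := \<lambda>_. 1)) = ?C (fdet n (weighted_laplacian(i := \<lambda>_. 1)))" for i
  proof -
    have "?L(i := \<lambda>_. 1) = (\<lambda>k j. ?C ((weighted_laplacian(i := \<lambda>_. 1)) k j))"
      by (auto simp: fun_eq_iff)
    then show ?thesis
      by (simp only: const)
  qed
  have "fdet n (\<lambda>i j. 1 + lap_series fps_X i j) = fdet n (\<lambda>i j. ?XL i j + 1 * 1)"
    by (rule fdet_cong) (simp add: fmat_X)
  also have "\<dots> = fdet n ?XL + (\<Sum>i<n. 1 * fdet n (?XL(i := \<lambda>_. 1)))"
    by (rule fdet_rank_one)
  also have "\<dots> = fps_X ^ (n - 1) * (\<Sum>i<n. ?C (fdet n (weighted_laplacian(i := \<lambda>_. 1))))"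
    using n by (simp add: scaled const fdet_laplacian row const_row sum_distrib_left)
  finally show ?thesis
    by (simp only: cofactor_sum_def fps_const_sum)
qed

text \<open>The all-ones matrix absorbs every power series in the Laplacian with constant term 1,
  so it can be carried through the factorization of \<open>1 - exp (- x)\<close>.\<close>

lemma heat_cycle_mat:
  assumes "n \<ge> 1"
  shows "heat (\<lambda>i j. 1 + of_bool (i = j)) (pmat id) =
    fps_X ^ (n - 1) * fps_const cofactor_sum * fdet n (lap_series phi)"
proof -
  let ?h = "fps_exp (-(1/2)) :: complex fps"
  let ?M = "\<lambda>i j. 1 + lap_series fps_X i j"
  let ?P = "mmul n (lap_series phi) (lap_series ?h)"
  have "diff_mat (\<lambda>i j. 1 + of_bool (i = j)) (pmat id) i j = mmul n ?M ?P i j"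
    if ij: "i < n" "j < n" for i j
  proof -
    have "(\<Sum>k<n. lap_series (fps_exp (-1)) i k * fps_const (pmat id k j)) =
        (\<Sum>k<n. lap_series (fps_exp (-1)) i k * of_bool (k = j))"
      by (intro sum.cong) (simp_all add: pmat_id of_bool_def)
    then have "diff_mat (\<lambda>i j. 1 + of_bool (i = j)) (pmat id) i j =
        1 + of_bool (i = j) - lap_series (fps_exp (-1)) i j"
      using sum_of_bool_mult(2)[OF ij(2), of "lap_series (fps_exp (-1)) i"]
      by (simp add: diff_mat_def of_bool_def numeral_fps_const)
    also have "\<dots> = 1 + lap_series (fps_X * (phi * ?h)) i j"
      by (simp add: phi_exp mult.assoc[symmetric] fmat_diff fmat_1)
    also have "\<dots> = (\<Sum>l<n. lap_series (phi * ?h) l j) + mmul n (lap_series fps_X) (lap_series (phi * ?h)) i j"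
      using ij by (simp add: sum_column_lap_series fmat_mmul phi_nth)
    also have "\<dots> = mmul n ?M (lap_series (phi * ?h)) i j"
      by (simp add: mmul_def algebra_simps sum.distrib)
    also have "\<dots> = mmul n ?M ?P i j"
      by (rule mmul_cong) (simp_all add: fmat_mmul ij)
    finally show ?thesis .
  qed
  then have "fdet n (diff_mat (\<lambda>i j. 1 + of_bool (i = j)) (pmat id)) = fdet n (mmul n ?M ?P)"
    by (rule fdet_cong)
  also have "\<dots> = fps_X ^ (n - 1) * fps_const cofactor_sum * (fdet n (lap_series phi) * fdet n (lap_series ?h))"
    by (simp only: fdet_mmul fdet_add_ones[OF assms])
  finally have "heat (\<lambda>i j. 1 + of_bool (i = j)) (pmat id) = fps_X ^ (n - 1) * fps_const cofactor_sum *
      fdet n (lap_series phi) * (exp_weight * fdet n (lap_series ?h))"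
    by (simp only: heat_def mult_ac)
  then show ?thesis
    by (simp only: exp_weight_fdet mult_1_right)
qed

section \<open>Comparison with genus 0\<close>

definition full_cycle_sum :: "nat \<Rightarrow> 'a" where
  "full_cycle_sum m = (\<Sum>es | set es \<subseteq> complete_edges n \<and> length es = m \<and> is_full_cycle n (edge_list_prod es).
    prod_list (map c es))"

lemma full_cycle_sum_heat:
  assumes n: "n \<ge> 1"
  obtains a :: complex where "a \<noteq> 0"
    "\<And>m. \<kappa> a * full_cycle_sum m = of_nat (fact m) * fps_nth (heat (\<lambda>i j. 1 + of_bool (i = j)) (pmat id)) m"
proof -
  obtain a :: complex where a: "a \<noteq> 0"
    "\<And>\<sigma>. \<sigma> permutes {1..n} \<Longrightarrow> fdet n (cycle_mat \<sigma>) = (if is_full_cycle n \<sigma> then a else 0)"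
    using fdet_cycle_mat_indicator[OF n] by metis
  \<comment> \<open>The kernel argument lives over the complex numbers; \<open>hom_fdet\<close>
    transports its result to the coefficient ring.\<close>
  have det: "fdet n (\<lambda>i j. 1 + of_bool (i = j) - pmat \<sigma> i j) = \<kappa> (if is_full_cycle n \<sigma> then a else 0)"
    if "\<sigma> permutes {1..n}" for \<sigma>
    unfolding a(2)[OF that, symmetric] hom_fdet
    by (rule fdet_cong) (simp add: cycle_mat_def pmat_def of_bool_def hom_minus hom_add)
  have fin: "finite (edge_lists m)" for m
    unfolding edge_lists_def by (rule finite_lists_length_eq[OF finite_complete_edges])
  have "\<kappa> a * full_cycle_sum m = of_nat (fact m) * fps_nth (heat (\<lambda>i j. 1 + of_bool (i = j)) (pmat id)) m" for m
  proof -
    have "of_nat (fact m) * fps_nth (heat (\<lambda>i j. 1 + of_bool (i = j)) (pmat id)) m =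
        (\<Sum>es\<in>edge_lists m. prod_list (map c es) * \<kappa> (if is_full_cycle n (edge_list_prod es) then a else 0))"
      unfolding heat_nth[OF permutes_id]
    proof (rule sum.cong[OF refl])
      fix es
      assume "es \<in> edge_lists m"
      then have "edge_list_prod es permutes {1..n}"
        by (intro edge_list_prod_permutes) (simp add: edge_lists_def)
      then show "prod_list (map c es) * fdet n (\<lambda>i j. 1 + of_bool (i = j) - pmat (edge_list_prod es \<circ> id) i j) =
          prod_list (map c es) * \<kappa> (if is_full_cycle n (edge_list_prod es) then a else 0)"
        by (simp only: comp_id det)
    qed
    also have "\<dots> = (\<Sum>es\<in>{es\<in>edge_lists m. is_full_cycle n (edge_list_prod es)}. prod_list (map c es) * \<kappa> a)"
      unfolding sum.inter_filter[OF fin] by (intro sum.cong refl) simp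
    also have "\<dots> = \<kappa> a * full_cycle_sum m"
      by (simp add: full_cycle_sum_def edge_lists_def sum_distrib_left conj_assoc mult.commute)
    finally show ?thesis by simp
  qed
  with a(1) show ?thesis
    using that by blast
qed

lemma full_cycle_sum_eq:
  assumes n: "n \<ge> 1"
  shows "full_cycle_sum (n - 1 + k) = of_nat (fact (n - 1 + k)) *
    (\<Sum>E\<in>spanning_trees n. \<Prod>e\<in>E. c e) * fps_nth (fdet n (lap_series phi)) k"
proof -
  let ?T = "\<Sum>E\<in>spanning_trees n. \<Prod>e\<in>E. c e" and ?F = "fdet n (lap_series phi)"
  obtain a :: complex where a: "a \<noteq> 0"
    "\<And>m. \<kappa> a * full_cycle_sum m = of_nat (fact m) * fps_nth (heat (\<lambda>i j. 1 + of_bool (i = j)) (pmat id)) m"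
    using full_cycle_sum_heat[OF n] by blast
  have eq: "\<kappa> a * full_cycle_sum (n - 1 + k) = of_nat (fact (n - 1 + k)) * (cofactor_sum * fps_nth ?F k)" for k
    unfolding a(2) heat_cycle_mat[OF n] by (simp add: mult.assoc fps_X_power_mult_nth)
  \<comment> \<open>At \<open>k = 0\<close> the determinant of phi(tA) contributes 1 and the
    left-hand side sums over orderings of spanning trees. This evaluates \<open>cofactor_sum\<close>
    up to the unit \<open>\<kappa> a\<close>.\<close>
  have "of_nat (fact (n - 1)) * (\<kappa> a * ?T) = of_nat (fact (n - 1)) * cofactor_sum"
    using eq[of 0] sum_full_cycle_products_genus_0[OF n, of c]
    by (simp add: full_cycle_sum_def fdet_lap_series_nth_0 phi_nth mult_ac)
  moreover obtain b where "fact (n - 1) = Suc b"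
    using fact_gt_zero[of "n - 1"] gr0_implies_Suc by blast
  ultimately have D: "\<kappa> a * ?T = cofactor_sum"
    using of_nat_mult_cancel by metis
  have unit: "\<kappa> (inverse a) * \<kappa> a = 1"
    using a(1) by (simp flip: hom_mult)
  then have "full_cycle_sum (n - 1 + k) = \<kappa> (inverse a) * (\<kappa> a * full_cycle_sum (n - 1 + k))"
    by (simp flip: mult.assoc)
  also have "\<dots> = \<kappa> (inverse a) * \<kappa> a * (of_nat (fact (n - 1 + k)) * ?T * fps_nth ?F k)"
    unfolding eq D[symmetric] by (simp only: mult_ac)
  finally show ?thesis
    by (simp only: unit mult_1_left)
qed

end

section \<open>The homogeneous parts of the determinantal series\<close>

text \<open>\<open>F\<close> is \<open>S\<close> with every variable multiplied by t. As its
  coefficients are polynomials, so are the homogeneous parts of \<open>S\<close>.\<close>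

definition graded :: "('v, 'a::comm_ring_1) mpoly fps \<Rightarrow> ('v, 'a) mseries \<Rightarrow> bool" where
  "graded F S \<longleftrightarrow> (\<forall>k m. Poly_Mapping.lookup (fps_nth F k) m = (if monom_degree m = k then mcoeff S m else 0))"

lemma graded_homogeneous_part:
  assumes "graded F S"
  shows "homogeneous_part k S = series_of_poly (fps_nth F k)"
  by (rule mseries_eqI) (use assms in \<open>simp add: graded_def homogeneous_part.rep_eq\<close>)

lemma lookup_mult: "Poly_Mapping.lookup (p * q) m =
    (\<Sum>(a, b)\<in>monom_splits m. Poly_Mapping.lookup p a * Poly_Mapping.lookup q b)"
  for p q :: "('v, 'a::comm_ring_1) mpoly"
proof -
  have "Poly_Mapping.lookup (p * q) m = mcoeff (series_of_poly p * series_of_poly q) m"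
    by (simp only: series_of_poly_mult[symmetric] mcoeff_series_of_poly)
  then show ?thesis
    by (simp add: times_mseries.rep_eq)
qed

lemma graded_0: "graded 0 0"
  by (simp add: graded_def zero_mseries.rep_eq)

lemma graded_1: "graded 1 1"
  by (auto simp: graded_def one_mseries.rep_eq fps_one_nth lookup_one when_def monom_degree_def)

lemma graded_add: "graded F S \<Longrightarrow> graded G U \<Longrightarrow> graded (F + G) (S + U)"
  by (simp add: graded_def plus_mseries.rep_eq lookup_add)

lemma graded_uminus: "graded F S \<Longrightarrow> graded (- F) (- S)"
  by (simp add: graded_def uminus_mseries.rep_eq)

lemma graded_mult:
  assumes F: "graded F S" and G: "graded G U"
  shows "graded (F * G) (S * U)"
  unfolding graded_def
proof (intro allI)
  fix k m
  have "Poly_Mapping.lookup (fps_nth (F * G) k) m = (\<Sum>i=0..k. \<Sum>(a, b)\<in>monom_splits m.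
      Poly_Mapping.lookup (fps_nth F i) a * Poly_Mapping.lookup (fps_nth G (k - i)) b)"
    by (simp add: fps_mult_nth lookup_sum lookup_mult)
  also have "\<dots> = (\<Sum>(a, b)\<in>monom_splits m. \<Sum>i=0..k.
      Poly_Mapping.lookup (fps_nth F i) a * Poly_Mapping.lookup (fps_nth G (k - i)) b)"
    by (subst sum.swap) (simp add: split_def)
  also have "\<dots> = (\<Sum>(a, b)\<in>monom_splits m. if monom_degree m = k then mcoeff S a * mcoeff U b else 0)"
  proof (intro sum.cong refl, clarify)
    fix a b
    assume "(a, b) \<in> monom_splits m"
    then have deg: "monom_degree m = monom_degree a + monom_degree b"
      by (auto simp: monom_splits_def monom_degree_add)
    \<comment> \<open>The monomial \<open>a\<close> occurs only in the coefficient of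
      \<open>F\<close> indexed by its own degree.\<close>
    have "(\<Sum>i=0..k. Poly_Mapping.lookup (fps_nth F i) a * Poly_Mapping.lookup (fps_nth G (k - i)) b) =
        (\<Sum>i=0..k. if i = monom_degree a then if monom_degree b = k - i then mcoeff S a * mcoeff U b else 0 else 0)"
      using F G unfolding graded_def by (intro sum.cong) auto
    also have "\<dots> = (if monom_degree m = k then mcoeff S a * mcoeff U b else 0)"
      using deg by auto
    finally show "(\<Sum>i=0..k. Poly_Mapping.lookup (fps_nth F i) a * Poly_Mapping.lookup (fps_nth G (k - i)) b) =
        (if monom_degree m = k then mcoeff S a * mcoeff U b else 0)" .
  qed
  also have "\<dots> = (if monom_degree m = k then mcoeff (S * U) m else 0)"
    by (auto simp: times_mseries.rep_eq)
  finally show "Poly_Mapping.lookup (fps_nth (F * G) k) m = (if monom_degree m = k then mcoeff (S * U) m else 0)" .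
qed

lemma graded_sum: "(\<And>x. x \<in> A \<Longrightarrow> graded (F x) (S x)) \<Longrightarrow> graded (sum F A) (sum S A)"
  by (induction A rule: infinite_finite_induct) (auto intro: graded_0 graded_add)

lemma graded_prod: "(\<And>x. x \<in> A \<Longrightarrow> graded (F x) (S x)) \<Longrightarrow> graded (prod F A) (prod S A)"
  by (induction A rule: infinite_finite_induct) (auto intro: graded_1 graded_mult)

lemma graded_signof: "graded (signof p) (signof p)"
  by (auto simp: sign_def graded_1 graded_uminus)

lemma graded_fdet:
  assumes "\<And>i j. i < n \<Longrightarrow> j < n \<Longrightarrow> graded (f i j) (g i j)"
  shows "graded (fdet n f) (fdet n g)"
  unfolding fdet_Leibniz
proof (intro graded_sum graded_mult graded_signof graded_prod assms)
  fix p i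
  assume "p \<in> {p. p permutes {0..<n}}" "i \<in> {..<n}"
  then show "p i < n"
    using permutes_in_image[of p "{0..<n}" i] by auto
qed auto

section \<open>Specialization to the polynomial ring in the edge variables\<close>

abbreviation scalar_poly :: "complex \<Rightarrow> (nat set, complex) mpoly" where
  "scalar_poly \<equiv> Poly_Mapping.single 0"

lemma comm_ring_hom_scalar_poly: "comm_ring_hom scalar_poly"
  by unfold_locales (simp_all add: single_add mult_single)

lemma lookup_scalar_poly_mult: "Poly_Mapping.lookup (scalar_poly a * p) m = a * Poly_Mapping.lookup p m"
proof -
  have "Poly_Mapping.lookup (scalar_poly a * p) m =
      (\<Sum>(b, d)\<in>{(0, m)}. Poly_Mapping.lookup (scalar_poly a) b * Poly_Mapping.lookup p d)"
    unfolding lookup_mult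
    by (rule sum.mono_neutral_right[OF finite_monom_splits])
      (auto simp: monom_splits_def lookup_single when_def split: if_splits)
  then show ?thesis by simp
qed

interpretation edges: weighted_edges scalar_poly n edge_var for n
  using comm_ring_hom_scalar_poly by (simp add: weighted_edges_def scalar_hom_def)

lemma edge_vec_mult:
  assumes "e \<in> complete_edges n"
  shows "edge_vec e i * edge_vec e j =
    (if i = j then of_bool (i \<in> e) else - of_bool (e = {i, j}) :: 'a::comm_ring_1)"
proof -
  define a b where ab: "a = Min e" "b = Max e"
  have "e = {a, b}" "a < b"
    using edge_ends(1,4)[OF assms] unfolding ab by auto
  moreover have "edge_vec e k = (of_bool (k = a) - of_bool (k = b) :: 'a)" for k
    by (simp add: edge_vec_def ab)
  ultimately show ?thesis
    by (auto simp: doubleton_eq_iff)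
qed

lemma laplacian_index:
  assumes "i < n" "j < n"
  shows "laplacian n $$ (i, j) = edges.weighted_laplacian n i j"
proof (cases "i = j")
  case True
  have "edges.weighted_laplacian n i j = (\<Sum>e\<in>complete_edges n. if Suc i \<in> e then edge_var e else 0)"
    unfolding edges.weighted_laplacian_def True
    by (intro sum.cong refl) (simp add: edge_vec_mult)
  also have "\<dots> = (\<Sum>e\<in>{e\<in>complete_edges n. Suc i \<in> e}. edge_var e)"
    by (rule sum.inter_filter[symmetric, OF finite_complete_edges])
  also have "{e\<in>complete_edges n. Suc i \<in> e} = (\<lambda>k. {Suc i, k}) ` ({1..n} - {Suc i})"
    using assms(1) unfolding complete_edges_def by fastforce
  also have "sum edge_var \<dots> = (\<Sum>k\<in>{1..n} - {Suc i}. w (Suc i) k)"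
    by (subst sum.reindex) (auto simp: inj_on_def doubleton_eq_iff w_def)
  finally show ?thesis
    using assms True by (simp add: laplacian_def laplacian_entry_def)
next
  case False
  have mem: "{Suc i, Suc j} \<in> complete_edges n"
    using assms False unfolding complete_edges_def by fastforce
  have "edges.weighted_laplacian n i j =
      (\<Sum>e\<in>complete_edges n. if e = {Suc i, Suc j} then - edge_var e else 0)"
    unfolding edges.weighted_laplacian_def
    using False by (intro sum.cong refl) (simp add: edge_vec_mult)
  also have "\<dots> = - w (Suc i) (Suc j)"
    using mem by (simp add: finite_complete_edges w_def)
  finally show ?thesis
    using assms False by (simp add: laplacian_def laplacian_entry_def)
qed

lemma laplacian_power_index:
  assumes "i < n" "j < n"
  shows "(laplacian n ^\<^sub>m k) $$ (i, j) = mpow n (edges.weighted_laplacian n) k i j"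
  using assms
proof (induction k arbitrary: i j)
  case 0
  then show ?case by (simp add: laplacian_def)
next
  case (Suc k)
  have car: "laplacian n \<in> carrier_mat n n" "laplacian n ^\<^sub>m k \<in> carrier_mat n n"
    by (auto simp: laplacian_def)
  have "(laplacian n ^\<^sub>m Suc k) $$ (i, j) = (\<Sum>l<n. (laplacian n ^\<^sub>m k) $$ (i, l) * laplacian n $$ (l, j))"
    using Suc.prems car by (simp add: scalar_prod_def lessThan_atLeast0)
  also have "\<dots> = mpow n (edges.weighted_laplacian n) (Suc k) i j"
    using Suc by (simp add: mmul_def laplacian_index)
  finally show ?case .
qed

text \<open>Entries of the k-th power of the Laplacian are homogeneous of degree k, so the
  \<open>Sum_any\<close> behind a coefficient reduces to \<open>k = monom_degree m\<close>.\<close>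

lemma graded_R_series: "graded (fdet n (edges.lap_series n phi)) (R_series n)"
proof -
  let ?g = "\<lambda>i j. fps_mat_eval phi (laplacian n) $$ (i, j)"
  have dim: "dim_row (laplacian n) = n" "dim_col (laplacian n) = n"
    by (simp_all add: laplacian_def)
  have "R_series n = fdet n ?g"
    unfolding R_series_def fdet_def by (intro arg_cong[of _ _ det] eq_matI) (simp_all add: fps_mat_eval_def dim)
  moreover have "graded (edges.lap_series n phi i j) (?g i j)" if ij: "i < n" "j < n" for i j
    unfolding graded_def
  proof (intro allI)
    fix k m
    let ?L = "\<lambda>k. Poly_Mapping.lookup ((laplacian n ^\<^sub>m k) $$ (i, j)) m"
    have hom: "?L k = 0" if "k \<noteq> monom_degree m" for k
      using hom_poly_laplacian_power[OF ij, of k] that by (auto simp: hom_poly_def in_keys_iff)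
    have "mcoeff (?g i j) m = Sum_any (\<lambda>k. fps_nth phi k * ?L k)"
      using ij by (simp add: fps_mat_eval_def dim Abs_mseries_inverse)
    also have "\<dots> = (\<Sum>k\<in>{monom_degree m}. fps_nth phi k * ?L k)"
      by (rule Sum_any.expand_superset) (use hom in auto)
    finally have "mcoeff (?g i j) m = fps_nth phi (monom_degree m) * ?L (monom_degree m)" by simp
    moreover have "Poly_Mapping.lookup (fps_nth (edges.lap_series n phi i j) k) m = fps_nth phi k * ?L k"
      by (simp add: fmat_def lookup_scalar_poly_mult laplacian_power_index[OF ij])
    ultimately show "Poly_Mapping.lookup (fps_nth (edges.lap_series n phi i j) k) m =
        (if monom_degree m = k then mcoeff (?g i j) m else 0)"
      using hom[of k] by auto
  qed
  ultimately show ?thesis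
    by (simp only:) (rule graded_fdet)
qed

text \<open>Edges and transpositions correspond bijectively, and the points moved by
  \<open>edge_transp e\<close> form \<open>e\<close>, so the weights agree.\<close>

lemma hurwitz_poly_eq: "hurwitz_poly g n = edges.full_cycle_sum n (n + 2 * g - 1)"
proof -
  let ?A = "{es. set es \<subseteq> complete_edges n \<and> length es = n + 2 * g - 1 \<and> is_full_cycle n (edge_list_prod es)}"
  have "cycle_factorizations g n = map edge_transp ` ?A"
  proof (intro subset_antisym subsetI)
    fix ts
    assume ts: "ts \<in> cycle_factorizations g n"
    then have "ts \<in> lists (edge_transp ` complete_edges n)"
      by (auto simp: cycle_factorizations_def transpositions_eq)
    then obtain es where "ts = map edge_transp es" "es \<in> lists (complete_edges n)"
      unfolding lists_image by blast
    with ts show "ts \<in> map edge_transp ` ?A"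
      by (auto simp: cycle_factorizations_def edge_list_prod_def)
  qed (auto simp: cycle_factorizations_def edge_list_prod_def transpositions_eq intro!: imageI)
  moreover have "inj_on (map edge_transp) ?A"
    using inj_on_mapI[of edge_transp ?A] inj_on_subset[OF inj_on_edge_transp[of n]]
    by (metis (no_types, lifting) UN_least mem_Collect_eq)
  ultimately have "hurwitz_poly g n = (\<Sum>es\<in>?A. prod_list (map (w_transp \<circ> edge_transp) es))"
    unfolding hurwitz_poly_def by (simp add: sum.reindex)
  also have "\<dots> = (\<Sum>es\<in>?A. prod_list (map edge_var es))"
    by (intro sum.cong refl arg_cong[of _ _ prod_list] map_cong)
      (auto simp: w_transp_def edge_transp_support)
  finally show ?thesis
    by (simp add: edges.full_cycle_sum_def)
qed

theorem theorem1:
  fixes n g :: nat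
  assumes "n \<ge> 1"
  shows "series_of_poly (hurwitz_poly g n)
    = of_nat (fact (n + 2 * g - 1)) * series_of_poly (tree_poly n) * R_part g n"
proof -
  \<comment> \<open>With truncated subtraction, this regrouping relies on
    \<open>n \<ge> 1\<close>.\<close>
  have m: "n + 2 * g - 1 = n - 1 + 2 * g"
    using assms by simp
  have of_nat: "series_of_poly (of_nat k :: (nat set, complex) mpoly) = of_nat k" for k
    by (induction k) simp_all
  have "R_part g n = series_of_poly (fps_nth (fdet n (edges.lap_series n phi)) (2 * g))"
    unfolding R_part_def by (rule graded_homogeneous_part[OF graded_R_series])
  then show ?thesis
    unfolding hurwitz_poly_eq m edges.full_cycle_sum_eq[OF assms] tree_poly_def
    by (simp only: series_of_poly_mult of_nat)
qed

end
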